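(* Let $C$ be a set, considered as a comonoid in the category of sets. Then: (1) Every comodule over $C$ is isomorphic to $\coprod_{c\in C}U_c$ for some collection of sets $(U_c)_{c\in C}$ parametrised by $C$. (2) Every contramodule over $C$ is isomorphic to $\prod_{c\in C}V_c$ for some collection of sets $(V_c)_{c\in C}$ parametrised by $C$. (3) The functors $L$ (from $C$-contramodules to $C$-comodules) and $R$ (from $C$-comodules to $C$-contramodules) are characterised by $$L\Big(\prod_{c\in C}V_c\Big)=\coprod_{c\in C}V_c,\qquad R\Big(\coprod_{c\in C}U_c\Big)=\prod_{c\in C}U_c,$$ where in the first formula all the sets $V_c$ must be non-empty.
   Context: The category of sets is monoidal under cartesian product; $[X,Y]$ is the set of functions $X\to Y$. Every set $C$ has a unique comonoid structure, given by the diagonal $C\to C\times C$ and the map to a point. A $C$-comodule is a set $X$ with $\rho:X\to X\times C$ that is coassociative and counital; equivalently $\rho=(\mathrm{id},\phi)$ for a function $\phi:X\to C$. The set $\coprod_{c\in C}U_c$ is a comodule via $\phi(x)=c$ for $x\in U_c$. A $C$-contramodule is a set $X$ with $\theta:[C,X]\to X$ such that $\theta$ of a constant function with value $x$ is $x$, and for every $\gamma:C\times C\to X$, $\theta\big(a\mapsto\theta(\gamma(a,-))\big)=\theta\big(a\mapsto\gamma(a,a)\big)$. The set $\prod_{c\in C}V_c$ is a contramodule via $\theta(\beta)(a)=\beta_a(a)$ for $\beta=(\beta_a)_{a\in C}$ with $\beta_a\in\prod_cV_c$. Morphisms of comodules and of contramodules are functions commuting with structure maps. $R(X)=[C,X]_C$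 is the set of sections of $\phi:X\to C$, with contramodule structure $\theta(\beta)(a)=\beta_a(a)$. $L(Y)$ is the coequaliser of the two maps $[C,Y]\times C\rightrightarrows Y\times C$, $(\beta,a)\mapsto(\beta(a),a)$ and $(\beta,a)\mapsto(\theta(\beta),a)$, with comodule structure induced by projection to $C$. Equalities in (3) are understood as canonical isomorphisms. *)

theory Defs
  imports "HOL-Library.FuncSet"
begin

text \<open>
  Sets are carriers \<open>A :: 'a set\<close>, and the set of functions from \<open>A\<close> to \<open>B\<close> is the library's
  extensional function space \<open>A \<rightarrow>\<^sub>E B\<close>, so that equality of functions is equality of terms.
  The composite of \<open>f\<close> and \<open>g\<close> with domain \<open>A\<close> is \<open>compose A g f\<close>, the identity is
  \<open>\<lambda>x\<in>A. x\<close>, and products and disjoint unions of families indexed by \<open>C\<close> are \<open>PiE C V\<close> and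
  \<open>Sigma C U\<close>.  The set \<open>C\<close> is an arbitrary, possibly empty, carrier.
\<close>

section \<open>Comodules\<close>

text \<open>The comonoid structure carried by every set: the diagonal and the map to a point.\<close>

definition set_comult :: "'c \<Rightarrow> 'c \<times> 'c" where
  "set_comult c = (c, c)"

definition set_counit :: "'c \<Rightarrow> unit" where
  "set_counit c = ()"

definition prod_assoc :: "('x \<times> 'c) \<times> 'd \<Rightarrow> 'x \<times> ('c \<times> 'd)" where
  "prod_assoc = (\<lambda>((x, c), d). (x, (c, d)))"

datatype ('c, 'x) comod =
  Comod (comod_carrier: "'x set") (coaction: "'x \<Rightarrow> 'x \<times> 'c")

definition is_comodule :: "'c set \<Rightarrow> ('c, 'x) comod \<Rightarrow> bool" where
  "is_comodule C X \<longleftrightarrow>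
     coaction X \<in> comod_carrier X \<rightarrow>\<^sub>E comod_carrier X \<times> C \<and>
     (\<forall>x\<in>comod_carrier X.
        map_prod id set_comult (coaction X x) = prod_assoc (map_prod (coaction X) id (coaction X x))) \<and>
     (\<forall>x\<in>comod_carrier X. map_prod id set_counit (coaction X x) = (x, ()))"

definition comod_hom :: "('c, 'x) comod \<Rightarrow> ('c, 'y) comod \<Rightarrow> ('x \<Rightarrow> 'y) set" where
  "comod_hom X Y =
     {f \<in> comod_carrier X \<rightarrow>\<^sub>E comod_carrier Y.
        \<forall>x\<in>comod_carrier X. coaction Y (f x) = map_prod f id (coaction X x)}"

definition comod_id :: "('c, 'x) comod \<Rightarrow> 'x \<Rightarrow> 'x" where
  "comod_id X = (\<lambda>x\<in>comod_carrier X. x)"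

definition comod_iso :: "'c set \<Rightarrow> ('c, 'x) comod \<Rightarrow> ('c, 'y) comod \<Rightarrow> ('x \<Rightarrow> 'y) \<Rightarrow> bool" where
  "comod_iso C X Y f \<longleftrightarrow>
     is_comodule C X \<and> is_comodule C Y \<and> f \<in> comod_hom X Y \<and>
     (\<exists>g\<in>comod_hom Y X.
        compose (comod_carrier X) g f = comod_id X \<and>
        compose (comod_carrier Y) f g = comod_id Y)"

definition comod_isomorphic :: "'c set \<Rightarrow> ('c, 'x) comod \<Rightarrow> ('c, 'y) comod \<Rightarrow> bool" where
  "comod_isomorphic C X Y \<longleftrightarrow> (\<exists>f. comod_iso C X Y f)"

definition coprod_comod :: "'c set \<Rightarrow> ('c \<Rightarrow> 'u set) \<Rightarrow> ('c, 'c \<times> 'u) comod" where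
  "coprod_comod C U = Comod (Sigma C U) (\<lambda>x\<in>Sigma C U. (x, fst x))"

definition coprod_map ::
  "'c set \<Rightarrow> ('c \<Rightarrow> 'u set) \<Rightarrow> ('c \<Rightarrow> 'u \<Rightarrow> 'w) \<Rightarrow> 'c \<times> 'u \<Rightarrow> 'c \<times> 'w" where
  "coprod_map C U f = (\<lambda>x\<in>Sigma C U. (fst x, f (fst x) (snd x)))"


section \<open>Contramodules\<close>

datatype ('c, 'y) contramod =
  Contramod (contra_carrier: "'y set") (contraaction: "('c \<Rightarrow> 'y) \<Rightarrow> 'y")

definition is_contramodule :: "'c set \<Rightarrow> ('c, 'y) contramod \<Rightarrow> bool" where
  "is_contramodule C Y \<longleftrightarrow>
     contraaction Y \<in> (C \<rightarrow>\<^sub>E contra_carrier Y) \<rightarrow>\<^sub>E contra_carrier Y \<and>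
     (\<forall>y\<in>contra_carrier Y. contraaction Y (\<lambda>a\<in>C. y) = y) \<and>
     (\<forall>\<gamma>\<in>C \<times> C \<rightarrow>\<^sub>E contra_carrier Y.
        contraaction Y (\<lambda>a\<in>C. contraaction Y (\<lambda>b\<in>C. \<gamma> (a, b))) =
        contraaction Y (\<lambda>a\<in>C. \<gamma> (a, a)))"

definition contra_hom ::
  "'c set \<Rightarrow> ('c, 'y) contramod \<Rightarrow> ('c, 'z) contramod \<Rightarrow> ('y \<Rightarrow> 'z) set" where
  "contra_hom C Y Z =
     {f \<in> contra_carrier Y \<rightarrow>\<^sub>E contra_carrier Z.
        \<forall>\<beta>\<in>C \<rightarrow>\<^sub>E contra_carrier Y. f (contraaction Y \<beta>) = contraaction Z (compose C f \<beta>)}"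

definition contra_id :: "('c, 'y) contramod \<Rightarrow> 'y \<Rightarrow> 'y" where
  "contra_id Y = (\<lambda>y\<in>contra_carrier Y. y)"

definition contra_iso ::
  "'c set \<Rightarrow> ('c, 'y) contramod \<Rightarrow> ('c, 'z) contramod \<Rightarrow> ('y \<Rightarrow> 'z) \<Rightarrow> bool" where
  "contra_iso C Y Z f \<longleftrightarrow>
     is_contramodule C Y \<and> is_contramodule C Z \<and> f \<in> contra_hom C Y Z \<and>
     (\<exists>g\<in>contra_hom C Z Y.
        compose (contra_carrier Y) g f = contra_id Y \<and>
        compose (contra_carrier Z) f g = contra_id Z)"

definition contra_isomorphic :: "'c set \<Rightarrow> ('c, 'y) contramod \<Rightarrow> ('c, 'z) contramod \<Rightarrow> bool" where
  "contra_isomorphic C Y Z \<longleftrightarrow> (\<exists>f. contra_iso C Y Z f)"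

definition prod_contra :: "'c set \<Rightarrow> ('c \<Rightarrow> 'v set) \<Rightarrow> ('c, 'c \<Rightarrow> 'v) contramod" where
  "prod_contra C V = Contramod (PiE C V) (\<lambda>\<beta>\<in>C \<rightarrow>\<^sub>E PiE C V. \<lambda>a\<in>C. \<beta> a a)"

definition prod_map ::
  "'c set \<Rightarrow> ('c \<Rightarrow> 'v set) \<Rightarrow> ('c \<Rightarrow> 'v \<Rightarrow> 'w) \<Rightarrow> ('c \<Rightarrow> 'v) \<Rightarrow> 'c \<Rightarrow> 'w" where
  "prod_map C V f = (\<lambda>v\<in>PiE C V. \<lambda>c\<in>C. f c (v c))"


section \<open>The functor R\<close>

definition comod_sections :: "'c set \<Rightarrow> ('c, 'x) comod \<Rightarrow> ('c \<Rightarrow> 'x) set" where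
  "comod_sections C X =
     {s \<in> C \<rightarrow>\<^sub>E comod_carrier X. \<forall>c\<in>C. snd (coaction X (s c)) = c}"

definition R_ob :: "'c set \<Rightarrow> ('c, 'x) comod \<Rightarrow> ('c, 'c \<Rightarrow> 'x) contramod" where
  "R_ob C X =
     Contramod (comod_sections C X) (\<lambda>\<beta>\<in>C \<rightarrow>\<^sub>E comod_sections C X. \<lambda>a\<in>C. \<beta> a a)"

definition R_mor ::
  "'c set \<Rightarrow> ('c, 'x) comod \<Rightarrow> ('c, 'x') comod \<Rightarrow> ('x \<Rightarrow> 'x') \<Rightarrow> ('c \<Rightarrow> 'x) \<Rightarrow> 'c \<Rightarrow> 'x'" where
  "R_mor C X X' f = (\<lambda>s\<in>comod_sections C X. compose C f s)"


section \<open>The functor L\<close>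

definition coeq_rel ::
  "'a set \<Rightarrow> 'b set \<Rightarrow> ('a \<Rightarrow> 'b) \<Rightarrow> ('a \<Rightarrow> 'b) \<Rightarrow> ('b \<times> 'b) set" where
  "coeq_rel A B p q =
     {(x, y) \<in> B \<times> B. equivclp (\<lambda>u v. \<exists>t\<in>A. u = p t \<and> v = q t) x y}"

definition L_rel :: "'c set \<Rightarrow> ('c, 'y) contramod \<Rightarrow> (('y \<times> 'c) \<times> ('y \<times> 'c)) set" where
  "L_rel C Y =
     coeq_rel ((C \<rightarrow>\<^sub>E contra_carrier Y) \<times> C) (contra_carrier Y \<times> C)
       (\<lambda>(\<beta>, a). (\<beta> a, a)) (\<lambda>(\<beta>, a). (contraaction Y \<beta>, a))"

definition L_carrier :: "'c set \<Rightarrow> ('c, 'y) contramod \<Rightarrow> ('y \<times> 'c) set set" where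
  "L_carrier C Y = (contra_carrier Y \<times> C) // L_rel C Y"

text \<open>
  A map out of the coequaliser induced by a map \<open>h\<close> on representatives sends a class \<open>K\<close> to the
  only element of \<open>h ` K\<close>.
\<close>

definition L_ob :: "'c set \<Rightarrow> ('c, 'y) contramod \<Rightarrow> ('c, ('y \<times> 'c) set) comod" where
  "L_ob C Y = Comod (L_carrier C Y) (\<lambda>K\<in>L_carrier C Y. (K, the_elem (snd ` K)))"

definition L_mor ::
  "'c set \<Rightarrow> ('c, 'y) contramod \<Rightarrow> ('c, 'y') contramod \<Rightarrow> ('y \<Rightarrow> 'y')
     \<Rightarrow> ('y \<times> 'c) set \<Rightarrow> ('y' \<times> 'c) set" where
  "L_mor C Y Y' f =
     (\<lambda>K\<in>L_carrier C Y. the_elem ((\<lambda>(y, a). L_rel C Y' `` {(f y, a)}) ` K))"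


section \<open>Functors and natural isomorphisms\<close>

text \<open>
  Each of the two categories consists of the objects whose carriers lie in a fixed type.
\<close>

definition contra_to_comod_functor ::
  "'c set \<Rightarrow> (('c, 'y) contramod \<Rightarrow> ('c, 'x) comod)
     \<Rightarrow> (('c, 'y) contramod \<Rightarrow> ('c, 'y) contramod \<Rightarrow> ('y \<Rightarrow> 'y) \<Rightarrow> 'x \<Rightarrow> 'x) \<Rightarrow> bool" where
  "contra_to_comod_functor C Fo Fm \<longleftrightarrow>
     (\<forall>Y. is_contramodule C Y \<longrightarrow> is_comodule C (Fo Y)) \<and>
     (\<forall>Y Z. is_contramodule C Y \<longrightarrow> is_contramodule C Z \<longrightarrow>
        (\<forall>f\<in>contra_hom C Y Z. Fm Y Z f \<in> comod_hom (Fo Y) (Fo Z))) \<and>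
     (\<forall>Y. is_contramodule C Y \<longrightarrow> Fm Y Y (contra_id Y) = comod_id (Fo Y)) \<and>
     (\<forall>Y Z W. is_contramodule C Y \<longrightarrow> is_contramodule C Z \<longrightarrow> is_contramodule C W \<longrightarrow>
        (\<forall>f\<in>contra_hom C Y Z. \<forall>g\<in>contra_hom C Z W.
           Fm Y W (compose (contra_carrier Y) g f) =
           compose (comod_carrier (Fo Y)) (Fm Z W g) (Fm Y Z f)))"

definition comod_to_contra_functor ::
  "'c set \<Rightarrow> (('c, 'x) comod \<Rightarrow> ('c, 'y) contramod)
     \<Rightarrow> (('c, 'x) comod \<Rightarrow> ('c, 'x) comod \<Rightarrow> ('x \<Rightarrow> 'x) \<Rightarrow> 'y \<Rightarrow> 'y) \<Rightarrow> bool" where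
  "comod_to_contra_functor C Fo Fm \<longleftrightarrow>
     (\<forall>X. is_comodule C X \<longrightarrow> is_contramodule C (Fo X)) \<and>
     (\<forall>X Z. is_comodule C X \<longrightarrow> is_comodule C Z \<longrightarrow>
        (\<forall>f\<in>comod_hom X Z. Fm X Z f \<in> contra_hom C (Fo X) (Fo Z))) \<and>
     (\<forall>X. is_comodule C X \<longrightarrow> Fm X X (comod_id X) = contra_id (Fo X)) \<and>
     (\<forall>X Z W. is_comodule C X \<longrightarrow> is_comodule C Z \<longrightarrow> is_comodule C W \<longrightarrow>
        (\<forall>f\<in>comod_hom X Z. \<forall>g\<in>comod_hom Z W.
           Fm X W (compose (comod_carrier X) g f) =
           compose (contra_carrier (Fo X)) (Fm Z W g) (Fm X Z f)))"

text \<open>Natural isomorphisms between the restrictions of two functors to a class of objects.\<close>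

definition contra_to_comod_nat_iso ::
  "'c set \<Rightarrow> ('c, 'y) contramod set
     \<Rightarrow> (('c, 'y) contramod \<Rightarrow> ('c, 'x) comod)
     \<Rightarrow> (('c, 'y) contramod \<Rightarrow> ('c, 'y) contramod \<Rightarrow> ('y \<Rightarrow> 'y) \<Rightarrow> 'x \<Rightarrow> 'x)
     \<Rightarrow> (('c, 'y) contramod \<Rightarrow> ('c, 'z) comod)
     \<Rightarrow> (('c, 'y) contramod \<Rightarrow> ('c, 'y) contramod \<Rightarrow> ('y \<Rightarrow> 'y) \<Rightarrow> 'z \<Rightarrow> 'z)
     \<Rightarrow> (('c, 'y) contramod \<Rightarrow> 'x \<Rightarrow> 'z) \<Rightarrow> bool" where
  "contra_to_comod_nat_iso C Obs Fo Fm Go Gm \<eta> \<longleftrightarrow>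
     (\<forall>Y\<in>Obs. comod_iso C (Fo Y) (Go Y) (\<eta> Y)) \<and>
     (\<forall>Y\<in>Obs. \<forall>Z\<in>Obs. \<forall>f\<in>contra_hom C Y Z.
        compose (comod_carrier (Fo Y)) (Gm Y Z f) (\<eta> Y) =
        compose (comod_carrier (Fo Y)) (\<eta> Z) (Fm Y Z f))"

definition comod_to_contra_nat_iso ::
  "'c set \<Rightarrow> ('c, 'x) comod set
     \<Rightarrow> (('c, 'x) comod \<Rightarrow> ('c, 'y) contramod)
     \<Rightarrow> (('c, 'x) comod \<Rightarrow> ('c, 'x) comod \<Rightarrow> ('x \<Rightarrow> 'x) \<Rightarrow> 'y \<Rightarrow> 'y)
     \<Rightarrow> (('c, 'x) comod \<Rightarrow> ('c, 'z) contramod)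
     \<Rightarrow> (('c, 'x) comod \<Rightarrow> ('c, 'x) comod \<Rightarrow> ('x \<Rightarrow> 'x) \<Rightarrow> 'z \<Rightarrow> 'z)
     \<Rightarrow> (('c, 'x) comod \<Rightarrow> 'y \<Rightarrow> 'z) \<Rightarrow> bool" where
  "comod_to_contra_nat_iso C Obs Fo Fm Go Gm \<eta> \<longleftrightarrow>
     (\<forall>X\<in>Obs. contra_iso C (Fo X) (Go X) (\<eta> X)) \<and>
     (\<forall>X\<in>Obs. \<forall>Z\<in>Obs. \<forall>f\<in>comod_hom X Z.
        compose (contra_carrier (Fo X)) (Gm X Z f) (\<eta> X) =
        compose (contra_carrier (Fo X)) (\<eta> Z) (Fm X Z f))"


section \<open>The formulas for L and R\<close>

text \<open>
  \<open>prod_to_coprod C Fo Fm \<alpha>\<close> says that the maps \<open>\<alpha> V\<close> identify \<open>Fo\<close> of the product of \<open>V\<close> with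
  the coproduct of \<open>V\<close>, for every family \<open>V\<close> of non-empty sets, naturally in \<open>V\<close>.
\<close>

definition prod_to_coprod ::
  "'c set \<Rightarrow> (('c, 'c \<Rightarrow> 'v) contramod \<Rightarrow> ('c, 'x) comod)
     \<Rightarrow> (('c, 'c \<Rightarrow> 'v) contramod \<Rightarrow> ('c, 'c \<Rightarrow> 'v) contramod
           \<Rightarrow> (('c \<Rightarrow> 'v) \<Rightarrow> ('c \<Rightarrow> 'v)) \<Rightarrow> 'x \<Rightarrow> 'x)
     \<Rightarrow> (('c \<Rightarrow> 'v set) \<Rightarrow> 'x \<Rightarrow> 'c \<times> 'v) \<Rightarrow> bool" where
  "prod_to_coprod C Fo Fm \<alpha> \<longleftrightarrow>
     (\<forall>V. (\<forall>c\<in>C. V c \<noteq> {}) \<longrightarrow>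
        comod_iso C (Fo (prod_contra C V)) (coprod_comod C V) (\<alpha> V)) \<and>
     (\<forall>V W f. (\<forall>c\<in>C. V c \<noteq> {}) \<longrightarrow> (\<forall>c\<in>C. W c \<noteq> {}) \<longrightarrow> (\<forall>c\<in>C. f c \<in> V c \<rightarrow> W c) \<longrightarrow>
        compose (comod_carrier (Fo (prod_contra C V))) (coprod_map C V f) (\<alpha> V) =
        compose (comod_carrier (Fo (prod_contra C V))) (\<alpha> W)
          (Fm (prod_contra C V) (prod_contra C W) (prod_map C V f)))"

definition coprod_to_prod ::
  "'c set \<Rightarrow> (('c, 'c \<times> 'u) comod \<Rightarrow> ('c, 'y) contramod)
     \<Rightarrow> (('c, 'c \<times> 'u) comod \<Rightarrow> ('c, 'c \<times> 'u) comod
           \<Rightarrow> ('c \<times> 'u \<Rightarrow> 'c \<times> 'u) \<Rightarrow> 'y \<Rightarrow> 'y)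
     \<Rightarrow> (('c \<Rightarrow> 'u set) \<Rightarrow> 'y \<Rightarrow> 'c \<Rightarrow> 'u) \<Rightarrow> bool" where
  "coprod_to_prod C Fo Fm \<alpha> \<longleftrightarrow>
     (\<forall>U. contra_iso C (Fo (coprod_comod C U)) (prod_contra C U) (\<alpha> U)) \<and>
     (\<forall>U W f. (\<forall>c\<in>C. f c \<in> U c \<rightarrow> W c) \<longrightarrow>
        compose (contra_carrier (Fo (coprod_comod C U))) (prod_map C U f) (\<alpha> U) =
        compose (contra_carrier (Fo (coprod_comod C U))) (\<alpha> W)
          (Fm (coprod_comod C U) (coprod_comod C W) (coprod_map C U f)))"

text \<open>
  The canonical maps: the class of \<open>(v, a)\<close> goes to the element \<open>v a\<close> of the summand with index
  \<open>a\<close>, and a section goes to the family of its values.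
\<close>

definition L_canonical ::
  "'c set \<Rightarrow> ('c \<Rightarrow> 'v set) \<Rightarrow> (('c \<Rightarrow> 'v) \<times> 'c) set \<Rightarrow> 'c \<times> 'v" where
  "L_canonical C V =
     (\<lambda>K\<in>L_carrier C (prod_contra C V). the_elem ((\<lambda>(v, a). (a, v a)) ` K))"

definition R_canonical ::
  "'c set \<Rightarrow> ('c \<Rightarrow> 'u set) \<Rightarrow> ('c \<Rightarrow> 'c \<times> 'u) \<Rightarrow> 'c \<Rightarrow> 'u" where
  "R_canonical C U = (\<lambda>s\<in>comod_sections C (coprod_comod C U). \<lambda>c\<in>C. snd (s c))"

text \<open>
  The formulas determine a functor up to natural isomorphism on the objects that are isomorphic to
  a product (coproduct) of sets in the given type.  Up to isomorphism, every object occurs for a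
  suitable choice of that type.
\<close>

definition product_contramodules :: "'c set \<Rightarrow> 'v itself \<Rightarrow> ('c, 'c \<Rightarrow> 'v) contramod set" where
  "product_contramodules C T =
     {Y. is_contramodule C Y \<and> (\<exists>V :: 'c \<Rightarrow> 'v set. contra_isomorphic C Y (prod_contra C V))}"

definition coproduct_comodules :: "'c set \<Rightarrow> 'u itself \<Rightarrow> ('c, 'c \<times> 'u) comod set" where
  "coproduct_comodules C T =
     {X. is_comodule C X \<and> (\<exists>U :: 'c \<Rightarrow> 'u set. comod_isomorphic C X (coprod_comod C U))}"

end

theory Submission
  imports Defs
begin

text \<open>
  The projections of a non-empty contramodule onto its factors are idempotents built from \<open>\<theta>\<close>, and
  they identify it with a product.  Every morphism between products of non-empty sets acts
  componentwise: two families with the same component at \<open>c\<close> are joined by a contraaction that only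
  sees that component.  The same argument shows that \<open>L\<close> of a product glues \<open>(v, c)\<close> and \<open>(w, c)\<close>
  exactly when \<open>v c = w c\<close>.  Hence a functor given by the formulas on componentwise maps is
  determined on all morphisms between non-empty products, by conjugation with chosen isomorphisms,
  and the empty contramodule is treated separately.  For \<open>R\<close> no such exception occurs, since every
  morphism of disjoint unions over \<open>C\<close> acts summandwise.
\<close>

section \<open>Comodules\<close>

text \<open>One computation in a product lies behind most steps: contraacting on a function with
  value \<open>v\<close> at \<open>c\<close> and \<open>v0\<close> elsewhere splices the two
  families into \<open>v0(c := v c)\<close>. The idempotents \<open>p c\<close> are this splice
  written with \<theta> alone, so they make sense in any contramodule with a chosen element, and
  their images play the part of the factors. The base point is also where non-emptiness enters. A
  product with one empty factor is empty and forgets all its other factors, while the disjoint union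
  remembers them; so neither the formula for \<open>L\<close> nor componentwise action can survive
  an empty factor. Hence the formula says nothing directly about the empty contramodule, and the
  value of a functor there has to be forced through its maps into non-empty products. Identifying an
  object with a product or a coproduct involves a choice, and a comparison built from choices is
  natural only if compatible with all morphisms. This is why componentwise naturality has to be
  extended to arbitrary morphisms before two functors can be compared.\<close>

lemma is_comodule_iff:
  "is_comodule C X \<longleftrightarrow> coaction X \<in> extensional (comod_carrier X) \<and>
     (\<forall>x\<in>comod_carrier X. fst (coaction X x) = x \<and> snd (coaction X x) \<in> C)"
proof -
  \<comment> \<open>Counitality makes the first component of \<open>coaction X x\<close> equal to
    \<open>x\<close>; with \<open>c\<close> as second component, both sides of coassociativity are
    then \<open>(x, (c, c))\<close>.\<close>
  have "coaction X x \<in> comod_carrier X \<times> C \<and>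
      map_prod id set_comult (coaction X x) = prod_assoc (map_prod (coaction X) id (coaction X x)) \<and>
      map_prod id set_counit (coaction X x) = (x, ()) \<longleftrightarrow>
    fst (coaction X x) = x \<and> snd (coaction X x) \<in> C" if "x \<in> comod_carrier X" for x
    using that by (cases "coaction X x") (auto simp: prod_assoc_def set_comult_def set_counit_def)
  then show ?thesis
    unfolding is_comodule_def PiE_iff by blast
qed

text \<open>The first components of the two sides of the morphism condition are both
  \<open>f x\<close>, so only compatibility with the maps to \<open>C\<close> remains: comodules are
  sets over \<open>C\<close>.\<close>

lemma comod_hom_iff:
  assumes "is_comodule C X" "is_comodule C Y"
  shows "f \<in> comod_hom X Y \<longleftrightarrow> f \<in> comod_carrier X \<rightarrow>\<^sub>E comod_carrier Y \<and>
     (\<forall>x\<in>comod_carrier X. snd (coaction Y (f x)) = snd (coaction X x))"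
  using assms by (auto simp: comod_hom_def is_comodule_iff prod_eq_iff PiE_iff)

lemma comod_hom_in: "f \<in> comod_hom X Y \<Longrightarrow> x \<in> comod_carrier X \<Longrightarrow> f x \<in> comod_carrier Y"
  by (auto simp: comod_hom_def)

lemma comod_hom_compose:
  assumes "is_comodule C X" "is_comodule C Y" "is_comodule C Z"
    and "f \<in> comod_hom X Y" "g \<in> comod_hom Y Z"
  shows "compose (comod_carrier X) g f \<in> comod_hom X Z"
  using assms comod_hom_in[OF assms(4)] comod_hom_in[OF assms(5)]
  by (simp add: comod_hom_iff[of C] compose_def)

lemma comod_hom_inv:
  assumes X: "is_comodule C X" and Y: "is_comodule C Y" and f: "f \<in> comod_hom X Y"
    and b: "bij_betw f (comod_carrier X) (comod_carrier Y)"
  shows "restrict (inv_into (comod_carrier X) f) (comod_carrier Y) \<in> comod_hom Y X"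
    (is "?g \<in> _")
proof -
  have g: "?g y \<in> comod_carrier X" "f (?g y) = y" if "y \<in> comod_carrier Y" for y
    using b that by (auto simp: bij_betw_def f_inv_into_f inv_into_into)
  have "snd (coaction X (?g y)) = snd (coaction Y y)" if "y \<in> comod_carrier Y" for y
    using f g(1)[OF that] g(2)[OF that] unfolding comod_hom_iff[OF X Y] by metis
  then show ?thesis
    using g(1) unfolding comod_hom_iff[OF Y X] by (intro conjI ballI restrict_PiE_iff[THEN iffD2]) auto
qed

lemma comod_iso_iff:
  "comod_iso C X Y f \<longleftrightarrow> is_comodule C X \<and> is_comodule C Y \<and> f \<in> comod_hom X Y \<and>
     bij_betw f (comod_carrier X) (comod_carrier Y)"
proof (cases "is_comodule C X \<and> is_comodule C Y \<and> f \<in> comod_hom X Y")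
  case True
  then have X: "is_comodule C X" and Y: "is_comodule C Y" and f: "f \<in> comod_hom X Y" by auto
  let ?A = "comod_carrier X" and ?B = "comod_carrier Y"
  have "bij_betw f ?A ?B"
    if g: "g \<in> comod_hom Y X" "compose ?A g f = comod_id X" "compose ?B f g = comod_id Y" for g
  proof (rule bij_betw_byWitness[where f' = g])
    show "\<forall>x\<in>?A. g (f x) = x" using g(2) by (metis comod_id_def compose_eq restrict_apply')
    show "\<forall>x\<in>?B. f (g x) = x" using g(3) by (metis comod_id_def compose_eq restrict_apply')
  qed (use f g in \<open>auto simp: comod_hom_in\<close>)
  moreover have "\<exists>g\<in>comod_hom Y X. compose ?A g f = comod_id X \<and> compose ?B f g = comod_id Y"
    if b: "bij_betw f ?A ?B"
    using comod_hom_inv[OF X Y f b] compose_inv_into_id[OF b] compose_id_inv_into b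
    unfolding comod_id_def by (metis bij_betw_imp_surj_on)
  ultimately show ?thesis using True by (auto simp: comod_iso_def)
qed (auto simp: comod_iso_def)

lemma comod_iso_compose:
  assumes "comod_iso C X Y f" "comod_iso C Y Z g"
  shows "comod_iso C X Z (compose (comod_carrier X) g f)"
  using assms bij_betw_compose[of f "comod_carrier X" "comod_carrier Y" g "comod_carrier Z"]
  by (simp add: comod_iso_iff comod_hom_compose[of C X Y Z])

lemma comod_iso_inv:
  assumes "comod_iso C X Y f"
  shows "comod_iso C Y X (restrict (inv_into (comod_carrier X) f) (comod_carrier Y))"
  using assms by (auto simp: comod_iso_iff comod_hom_inv bij_betw_restrict_eq bij_betw_inv_into)

lemma coprod_comod_simps [simp]:
  "comod_carrier (coprod_comod C U) = Sigma C U"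
  "x \<in> Sigma C U \<Longrightarrow> coaction (coprod_comod C U) x = (x, fst x)"
  by (simp_all add: coprod_comod_def)

lemma coprod_comod_comodule [simp]: "is_comodule C (coprod_comod C U)"
  by (auto simp: is_comodule_iff coprod_comod_def)

text \<open>The summands are the fibres of \<phi>, and the isomorphism tags each element with the
  index of its fibre.\<close>

lemma comodule_isomorphic_coprod:
  fixes X :: "('c, 'x) comod"
  assumes X: "is_comodule C X"
  shows "\<exists>U :: 'c \<Rightarrow> 'x set. comod_isomorphic C X (coprod_comod C U)"
proof -
  define \<phi> where "\<phi> x = snd (coaction X x)" for x
  define U where "U c = {x \<in> comod_carrier X. \<phi> x = c}" for c
  let ?f = "\<lambda>x\<in>comod_carrier X. (\<phi> x, x)"
  have "\<phi> x \<in> C" if "x \<in> comod_carrier X" for x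
    using X that by (simp add: is_comodule_iff \<phi>_def)
  then have "?f \<in> comod_hom X (coprod_comod C U)"
    and "bij_betw ?f (comod_carrier X) (Sigma C U)"
    by (auto simp: comod_hom_iff[OF X] bij_betw_def inj_on_def U_def \<phi>_def[symmetric] image_iff)
  then have "comod_iso C X (coprod_comod C U) ?f"
    by (simp add: comod_iso_iff X)
  then show ?thesis by (auto simp: comod_isomorphic_def)
qed

section \<open>Contramodules\<close>

lemma contramoduleD:
  assumes "is_contramodule C Y"
  shows contra_in: "\<beta> \<in> C \<rightarrow>\<^sub>E contra_carrier Y \<Longrightarrow> contraaction Y \<beta> \<in> contra_carrier Y"
    and contra_const: "y \<in> contra_carrier Y \<Longrightarrow> contraaction Y (\<lambda>a\<in>C. y) = y"
  using assms by (auto simp: is_contramodule_def)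

text \<open>Contraassociativity for curried functions, the form in which nested contraactions are
  collapsed in the decomposition into factors. A two-variable function is best pictured as an array
  that is replaced by its diagonal.\<close>

lemma contra_diag:
  assumes "is_contramodule C Y" "\<And>a b. a \<in> C \<Longrightarrow> b \<in> C \<Longrightarrow> g a b \<in> contra_carrier Y"
  shows "contraaction Y (\<lambda>a\<in>C. contraaction Y (\<lambda>b\<in>C. g a b)) = contraaction Y (\<lambda>a\<in>C. g a a)"
proof -
  let ?\<gamma> = "\<lambda>x\<in>C \<times> C. g (fst x) (snd x)"
  have "?\<gamma> \<in> C \<times> C \<rightarrow>\<^sub>E contra_carrier Y" using assms by auto
  then have "contraaction Y (\<lambda>a\<in>C. contraaction Y (\<lambda>b\<in>C. ?\<gamma> (a, b))) =
      contraaction Y (\<lambda>a\<in>C. ?\<gamma> (a, a))"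
    using assms(1) unfolding is_contramodule_def by blast
  then show ?thesis by (simp cong: restrict_cong)
qed

lemma contra_hom_in: "f \<in> contra_hom C X Y \<Longrightarrow> x \<in> contra_carrier X \<Longrightarrow> f x \<in> contra_carrier Y"
  by (auto simp: contra_hom_def)

lemma contra_hom_contraaction:
  "f \<in> contra_hom C Y Z \<Longrightarrow> \<beta> \<in> C \<rightarrow>\<^sub>E contra_carrier Y \<Longrightarrow>
    f (contraaction Y \<beta>) = contraaction Z (compose C f \<beta>)"
  by (auto simp: contra_hom_def)

lemma contra_homI:
  assumes "\<And>y. y \<in> contra_carrier Y \<Longrightarrow> f y \<in> contra_carrier Z" "f \<in> extensional (contra_carrier Y)"
    "\<And>\<beta>. \<beta> \<in> C \<rightarrow>\<^sub>E contra_carrier Y \<Longrightarrow>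
      f (contraaction Y \<beta>) = contraaction Z (compose C f \<beta>)"
  shows "f \<in> contra_hom C Y Z"
  using assms by (auto simp: contra_hom_def PiE_iff)

lemma contra_hom_compose:
  assumes "is_contramodule C X" "f \<in> contra_hom C X Y" "g \<in> contra_hom C Y Z"
  shows "compose (contra_carrier X) g f \<in> contra_hom C X Z"
proof -
  have "compose (contra_carrier X) g f (contraaction X \<beta>) =
      contraaction Z (compose C (compose (contra_carrier X) g f) \<beta>)"
    if \<beta>: "\<beta> \<in> C \<rightarrow>\<^sub>E contra_carrier X" for \<beta>
  proof -
    have "compose C f \<beta> \<in> C \<rightarrow>\<^sub>E contra_carrier Y"
      using contra_hom_in[OF assms(2)] PiE_mem[OF \<beta>] by (simp add: compose_def)
    moreover have "compose C (compose (contra_carrier X) g f) \<beta> = compose C g (compose C f \<beta>)"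
      using \<beta> by (auto simp: compose_def PiE_mem intro!: restrict_ext)
    ultimately show ?thesis
      using assms \<beta> by (simp add: compose_eq contra_in contra_hom_contraaction)
  qed
  then show ?thesis
    using assms(2,3) by (auto simp: contra_hom_def compose_def)
qed

text \<open>Since \<beta> is \<open>f\<close> after \<open>?g\<close> after \<beta>, the morphism
  property of \<open>f\<close> exhibits \<open>contraaction Z \<beta>\<close> as an
  \<open>f\<close>-image, and applying \<open>?g\<close> to it gives the claim.\<close>

lemma contra_hom_inv:
  assumes Y: "is_contramodule C Y" and f: "f \<in> contra_hom C Y Z"
    and b: "bij_betw f (contra_carrier Y) (contra_carrier Z)"
  shows "restrict (inv_into (contra_carrier Y) f) (contra_carrier Z) \<in> contra_hom C Z Y"
    (is "?g \<in> _")
proof -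
  have g: "?g z \<in> contra_carrier Y" "f (?g z) = z" if "z \<in> contra_carrier Z" for z
    using b that by (auto simp: bij_betw_def f_inv_into_f inv_into_into)
  have gf: "?g (f y) = y" if "y \<in> contra_carrier Y" for y
    using b that contra_hom_in[OF f that] by (simp add: bij_betw_def)
  have "?g (contraaction Z \<beta>) = contraaction Y (compose C ?g \<beta>)"
    if \<beta>: "\<beta> \<in> C \<rightarrow>\<^sub>E contra_carrier Z" for \<beta>
  proof -
    have g\<beta>: "compose C ?g \<beta> \<in> C \<rightarrow>\<^sub>E contra_carrier Y"
      using g(1) PiE_mem[OF \<beta>] by (simp add: compose_def)
    have "compose C f (compose C ?g \<beta>) = \<beta>"
    proof (rule extensionalityI[of _ C])
      show "compose C f (compose C ?g \<beta>) a = \<beta> a" if "a \<in> C" for a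
        using g(2)[OF PiE_mem[OF \<beta> that]] that by (simp add: compose_eq)
    qed (use \<beta> in \<open>auto simp: PiE_def\<close>)
    then have "contraaction Z \<beta> = f (contraaction Y (compose C ?g \<beta>))"
      using contra_hom_contraaction[OF f g\<beta>] by simp
    then show ?thesis using gf[OF contra_in[OF Y g\<beta>]] by simp
  qed
  then show ?thesis using g(1) by (auto simp: contra_hom_def)
qed

lemma contra_iso_iff:
  "contra_iso C Y Z f \<longleftrightarrow> is_contramodule C Y \<and> is_contramodule C Z \<and> f \<in> contra_hom C Y Z \<and>
     bij_betw f (contra_carrier Y) (contra_carrier Z)"
proof (cases "is_contramodule C Y \<and> is_contramodule C Z \<and> f \<in> contra_hom C Y Z")
  case True
  then have Y: "is_contramodule C Y" and f: "f \<in> contra_hom C Y Z" by auto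
  let ?A = "contra_carrier Y" and ?B = "contra_carrier Z"
  have "bij_betw f ?A ?B"
    if g: "g \<in> contra_hom C Z Y" "compose ?A g f = contra_id Y" "compose ?B f g = contra_id Z" for g
  proof (rule bij_betw_byWitness[where f' = g])
    show "\<forall>x\<in>?A. g (f x) = x" using g(2) by (metis contra_id_def compose_eq restrict_apply')
    show "\<forall>x\<in>?B. f (g x) = x" using g(3) by (metis contra_id_def compose_eq restrict_apply')
  qed (use f g in \<open>auto simp: contra_hom_in\<close>)
  moreover have "\<exists>g\<in>contra_hom C Z Y. compose ?A g f = contra_id Y \<and> compose ?B f g = contra_id Z"
    if b: "bij_betw f ?A ?B"
    using contra_hom_inv[OF Y f b] compose_inv_into_id[OF b] compose_id_inv_into b
    unfolding contra_id_def by (metis bij_betw_imp_surj_on)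
  ultimately show ?thesis using True by (auto simp: contra_iso_def)
qed (auto simp: contra_iso_def)

lemma contra_iso_compose:
  assumes "contra_iso C X Y f" "contra_iso C Y Z g"
  shows "contra_iso C X Z (compose (contra_carrier X) g f)"
  using assms bij_betw_compose[of f "contra_carrier X" "contra_carrier Y" g "contra_carrier Z"]
  by (auto simp: contra_iso_iff contra_hom_compose)

lemma contra_iso_inv:
  assumes "contra_iso C X Y f"
  shows "contra_iso C Y X (restrict (inv_into (contra_carrier X) f) (contra_carrier Y))"
  using assms by (auto simp: contra_iso_iff contra_hom_inv bij_betw_restrict_eq bij_betw_inv_into)

lemma prod_contra_simps [simp]:
  "contra_carrier (prod_contra C V) = PiE C V"
  "\<beta> \<in> C \<rightarrow>\<^sub>E PiE C V \<Longrightarrow> contraaction (prod_contra C V) \<beta> = (\<lambda>a\<in>C. \<beta> a a)"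
  by (simp_all add: prod_contra_def)

text \<open>Serves both products and sets of sections. At \<open>a\<close>, both sides of
  contraassociativity take the value \<open>\<gamma> (a, a) a\<close>.\<close>

lemma diag_contramodule:
  assumes "Y \<subseteq> extensional C" "\<And>\<beta>. \<beta> \<in> C \<rightarrow>\<^sub>E Y \<Longrightarrow> (\<lambda>a\<in>C. \<beta> a a) \<in> Y"
  shows "is_contramodule C (Contramod Y (\<lambda>\<beta>\<in>C \<rightarrow>\<^sub>E Y. \<lambda>a\<in>C. \<beta> a a))"
proof -
  have const: "restrict y C = y" if "y \<in> Y" for y
    using that assms(1) by (metis extensional_restrict subsetD)
  have "(\<lambda>a\<in>C. \<gamma> (a, a)) \<in> C \<rightarrow>\<^sub>E Y" "(\<lambda>a\<in>C. \<lambda>b\<in>C. \<gamma> (a, b) b) \<in> C \<rightarrow>\<^sub>E Y"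
    "\<forall>a\<in>C. (\<lambda>b\<in>C. \<gamma> (a, b)) \<in> C \<rightarrow>\<^sub>E Y"
    if \<gamma>: "\<gamma> \<in> C \<times> C \<rightarrow>\<^sub>E Y" for \<gamma>
  proof -
    have *: "(\<lambda>b\<in>C. \<gamma> (a, b)) \<in> C \<rightarrow>\<^sub>E Y" if "a \<in> C" for a
      using \<gamma> that by (auto simp: PiE_iff)
    show "\<forall>a\<in>C. (\<lambda>b\<in>C. \<gamma> (a, b)) \<in> C \<rightarrow>\<^sub>E Y" using * by blast
    have "(\<lambda>b\<in>C. \<gamma> (a, b) b) \<in> Y" if "a \<in> C" for a
      using assms(2)[OF *[OF that]] by (simp cong: restrict_cong)
    then show "(\<lambda>a\<in>C. \<lambda>b\<in>C. \<gamma> (a, b) b) \<in> C \<rightarrow>\<^sub>E Y" by auto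
  qed (use \<gamma> in \<open>auto simp: PiE_iff\<close>)
  then show ?thesis
    using assms(2) const by (auto simp: is_contramodule_def cong: restrict_cong)
qed

lemma prod_contra_contramodule [simp]: "is_contramodule C (prod_contra C V)"
  unfolding prod_contra_def by (rule diag_contramodule) (auto simp: PiE_iff)

text \<open>The contraaction of a product only reads diagonal values, so the morphism condition
  splits into one condition per coordinate.\<close>

lemma contra_iso_prod_contraI:
  assumes "is_contramodule C Y" "bij_betw f (contra_carrier Y) (PiE C V)"
    "f \<in> extensional (contra_carrier Y)"
    "\<And>\<beta> a. \<beta> \<in> C \<rightarrow>\<^sub>E contra_carrier Y \<Longrightarrow> a \<in> C \<Longrightarrow> f (contraaction Y \<beta>) a = f (\<beta> a) a"
  shows "contra_iso C Y (prod_contra C V) f"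
proof -
  have f: "f y \<in> PiE C V" if "y \<in> contra_carrier Y" for y
    using assms(2) that by (auto simp: bij_betw_def)
  have "f (contraaction Y \<beta>) = contraaction (prod_contra C V) (compose C f \<beta>)"
    if \<beta>: "\<beta> \<in> C \<rightarrow>\<^sub>E contra_carrier Y" for \<beta>
  proof -
    have "compose C f \<beta> \<in> C \<rightarrow>\<^sub>E PiE C V"
      using f \<beta> by (auto simp: compose_def PiE_mem intro!: restrict_PiE_iff[THEN iffD2])
    moreover have "f (contraaction Y \<beta>) = (\<lambda>a\<in>C. f (\<beta> a) a)"
      using f[OF contra_in[OF assms(1) \<beta>]] assms(4)[OF \<beta>]
      by (intro extensionalityI[of _ C]) (auto simp: PiE_def)
    ultimately show ?thesis by (simp add: compose_def cong: restrict_cong)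
  qed
  moreover have "f \<in> contra_carrier Y \<rightarrow>\<^sub>E PiE C V"
    using f assms(3) by (auto simp only: PiE_iff)
  ultimately show ?thesis
    using assms(1,2) by (simp add: contra_iso_iff contra_hom_def)
qed

text \<open>
  If \<open>Y\<close> has an element \<open>y0\<close>, the projection to the factor of index \<open>c\<close> is the idempotent
  \<open>p c\<close> of \<open>Y\<close> that applies \<open>\<theta>\<close> to the function with value \<open>y\<close> at \<open>c\<close> and \<open>y0\<close> elsewhere.
\<close>

lemma contramodule_isomorphic_prod:
  fixes Y :: "('c, 'y) contramod"
  assumes Y: "is_contramodule C Y"
  shows "\<exists>V :: 'c \<Rightarrow> 'y set. contra_isomorphic C Y (prod_contra C V)"
proof (cases "contra_carrier Y = {}")
  case True
  \<comment> \<open>Over an empty \<open>C\<close> the function \<open>\<lambda>_. undefined\<close>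
    lies in the extensional function space, and its contraaction would be an element of the empty
    carrier. With an index available, the product of empty sets is empty too.\<close>
  have "C \<noteq> {}"
    using contra_in[OF Y, of "\<lambda>_. undefined"] True by auto
  then have "PiE C (\<lambda>_. {} :: 'y set) = {}" by auto
  then have "contra_iso C Y (prod_contra C (\<lambda>_. {} :: 'y set)) (\<lambda>_. undefined)"
    using True \<open>C \<noteq> {}\<close> by (intro contra_iso_prod_contraI[OF Y]) (auto simp: bij_betw_def)
  then show ?thesis by (auto simp: contra_isomorphic_def)
next
  case False
  then obtain y0 where y0: "y0 \<in> contra_carrier Y" by auto
  let ?A = "contra_carrier Y"
  define \<theta> where "\<theta> = contraaction Y"
  define p where "p c y = \<theta> (\<lambda>a\<in>C. if a = c then y else y0)" for c y
  define V where "V c = p c ` ?A" for c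
  define f where "f = (\<lambda>y\<in>?A. \<lambda>c\<in>C. p c y)"
  have in_A: "\<theta> (\<lambda>a\<in>C. g a) \<in> ?A" if "\<And>a. a \<in> C \<Longrightarrow> g a \<in> ?A" for g
    unfolding \<theta>_def using that by (intro contra_in[OF Y]) auto
  have diag: "\<theta> (\<lambda>a\<in>C. \<theta> (\<lambda>b\<in>C. g a b)) = \<theta> (\<lambda>a\<in>C. g a a)"
    if "\<And>a b. a \<in> C \<Longrightarrow> b \<in> C \<Longrightarrow> g a b \<in> ?A" for g
    unfolding \<theta>_def using that by (intro contra_diag[OF Y]) auto
  have const: "\<theta> (\<lambda>a\<in>C. y) = y" if "y \<in> ?A" for y
    unfolding \<theta>_def using that by (rule contra_const[OF Y])
  have p_in: "p c y \<in> ?A" if "y \<in> ?A" for c y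
    unfolding p_def using that y0 by (intro in_A) auto
  \<comment> \<open>The array has \<open>g c\<close> on the diagonal and \<open>y0\<close> off it.
    For constant \<open>g\<close> this says that \<theta> recovers an element from its
    projections.\<close>
  have p_sum: "\<theta> (\<lambda>c\<in>C. p c (g c)) = \<theta> (\<lambda>c\<in>C. g c)" if "\<And>a. a \<in> C \<Longrightarrow> g a \<in> ?A" for g
    unfolding p_def using that y0 by (subst diag) auto
  have p_theta: "p c (\<theta> (\<lambda>a\<in>C. g a)) = p c (g c)"
    if g: "\<And>a. a \<in> C \<Longrightarrow> g a \<in> ?A" and c: "c \<in> C" for g c
  proof -
    \<comment> \<open>To obtain a nested contraaction, the entries \<open>y0\<close> are rewritten
      as \<theta> of a constant function. Row \<open>c\<close> of the array is \<open>g\<close>, all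
      other rows are constantly \<open>y0\<close>, and so the diagonal is the function that defines
      \<open>p c (g c)\<close>.\<close>
    have "p c (\<theta> (\<lambda>a\<in>C. g a)) = \<theta> (\<lambda>a\<in>C. \<theta> (\<lambda>b\<in>C. if a = c then g b else y0))"
      unfolding p_def using y0 by (intro arg_cong[of _ _ \<theta>] restrict_ext) (simp add: const)
    also have "\<dots> = \<theta> (\<lambda>a\<in>C. if a = c then g a else y0)"
      using g y0 by (subst diag) auto
    also have "\<dots> = p c (g c)"
      unfolding p_def by (intro arg_cong[of _ _ \<theta>] restrict_ext) simp
    finally show ?thesis .
  qed
  \<comment> \<open>The inner \<open>p c y\<close> is itself a contraaction, of a function whose
    entry at \<open>c\<close> is \<open>y\<close>.\<close>
  have p_idem: "p c (p c y) = p c y" if "c \<in> C" "y \<in> ?A" for c y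
    using p_theta[of "\<lambda>a. if a = c then y else y0" c] that y0 by (simp add: p_def[of c y])
  have "contra_iso C Y (prod_contra C V) f"
  proof (rule contra_iso_prod_contraI[OF Y])
    show "f (contraaction Y \<beta>) a = f (\<beta> a) a" if \<beta>: "\<beta> \<in> C \<rightarrow>\<^sub>E ?A" and a: "a \<in> C" for \<beta> a
    proof -
      have "\<beta> = (\<lambda>a\<in>C. \<beta> a)" using \<beta> by (simp add: PiE_def extensional_restrict)
      then have "p a (\<theta> \<beta>) = p a (\<beta> a)"
        using p_theta[of \<beta> a] \<beta> a by (auto simp: PiE_mem)
      then show ?thesis
        using contra_in[OF Y \<beta>] PiE_mem[OF \<beta> a] a by (simp add: f_def \<theta>_def)
    qed
    show "bij_betw f ?A (PiE C V)"
    \<comment> \<open>Each \<open>V c\<close> is a subset of \<open>?A\<close>, so an element of the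
      product is itself a function from \<open>C\<close> to the carrier and \<theta> applies to it
      directly.\<close>
    proof (rule bij_betw_byWitness[where f' = \<theta>])
      show "\<forall>y\<in>?A. \<theta> (f y) = y" using p_sum const by (simp add: f_def)
      show "f ` ?A \<subseteq> PiE C V" by (auto simp: f_def V_def)
      have \<beta>: "\<beta> = (\<lambda>a\<in>C. \<beta> a)" "\<And>a. a \<in> C \<Longrightarrow> \<beta> a \<in> ?A \<and> p a (\<beta> a) = \<beta> a"
        if "\<beta> \<in> PiE C V" for \<beta>
      proof -
        show "\<beta> = (\<lambda>a\<in>C. \<beta> a)" using that by (simp add: PiE_def extensional_restrict)
        show "\<beta> a \<in> ?A \<and> p a (\<beta> a) = \<beta> a" if "a \<in> C" for a
          using PiE_mem[OF \<open>\<beta> \<in> PiE C V\<close> that] that by (auto simp: V_def p_in p_idem)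
      qed
      have \<theta>\<beta>: "\<theta> \<beta> \<in> ?A" if "\<beta> \<in> PiE C V" for \<beta>
        using \<beta>[OF that] in_A[of \<beta>] by metis
      then show "\<theta> ` PiE C V \<subseteq> ?A" by blast
      show "\<forall>\<beta>\<in>PiE C V. f (\<theta> \<beta>) = \<beta>"
      proof
        fix \<beta> assume b: "\<beta> \<in> PiE C V"
        have "p c (\<theta> \<beta>) = \<beta> c" if "c \<in> C" for c
          using \<beta>[OF b] p_theta[of \<beta> c] that by metis
        then show "f (\<theta> \<beta>) = \<beta>"
          using \<theta>\<beta>[OF b] b by (intro extensionalityI[of _ C]) (auto simp: f_def PiE_def)
      qed
    qed
  qed (simp add: f_def)
  then show ?thesis by (auto simp: contra_isomorphic_def)
qed

section \<open>Morphisms of coproducts and of products\<close>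

lemma coprod_hom_eq_coprod_map:
  assumes h: "h \<in> comod_hom (coprod_comod C U) (coprod_comod C W)"
  obtains f where "\<forall>c\<in>C. f c \<in> U c \<rightarrow> W c" "h = coprod_map C U f"
proof
  have h': "h x \<in> Sigma C W" "fst (h x) = fst x" if "x \<in> Sigma C U" for x
  proof -
    show *: "h x \<in> Sigma C W" using comod_hom_in[OF h] that by simp
    have "snd (coaction (coprod_comod C W) (h x)) = snd (coaction (coprod_comod C U) x)"
      using h that unfolding comod_hom_iff[OF coprod_comod_comodule coprod_comod_comodule]
        coprod_comod_simps(1) by blast
    then show "fst (h x) = fst x" using * that by simp
  qed
  show "\<forall>c\<in>C. (\<lambda>u. snd (h (c, u))) \<in> U c \<rightarrow> W c"
  proof (intro ballI funcsetI)
    fix c u assume "c \<in> C" "u \<in> U c"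
    then show "snd (h (c, u)) \<in> W c"
      using h'[of "(c, u)"] by (cases "h (c, u)") auto
  qed
  show "h = coprod_map C U (\<lambda>c u. snd (h (c, u)))"
  proof (rule extensionalityI[of _ "Sigma C U"])
    show "h \<in> extensional (Sigma C U)" using h by (auto simp: comod_hom_def PiE_def)
    show "h x = coprod_map C U (\<lambda>c u. snd (h (c, u))) x" if "x \<in> Sigma C U" for x
      using h'[OF that] that by (simp add: coprod_map_def prod_eq_iff)
  qed (simp add: coprod_map_def)
qed

lemma coprod_map_hom:
  assumes "\<forall>c\<in>C. f c \<in> U c \<rightarrow> W c"
  shows "coprod_map C U f \<in> comod_hom (coprod_comod C U) (coprod_comod C W)"
  using assms by (auto simp: comod_hom_iff[of C] coprod_map_def Pi_iff)

text \<open>Non-emptiness is essential here: if some \<open>V d\<close> is empty, the empty map can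
  be a morphism even when another \<open>V c\<close> has elements and \<open>W c\<close> has none,
  and then no \<open>f c\<close> exists.\<close>

lemma prod_hom_eq_prod_map:
  assumes V: "\<forall>c\<in>C. V c \<noteq> {}"
    and g: "g \<in> contra_hom C (prod_contra C V) (prod_contra C W)"
  obtains f where "\<forall>c\<in>C. f c \<in> V c \<rightarrow> W c" "g = prod_map C V f"
proof -
  obtain v0 where v0: "v0 \<in> PiE C V"
    using V by (metis PiE_eq_empty_iff ex_in_conv)
  define f where "f c x = g (v0(c := x)) c" for c x
  have upd: "v(c := x) \<in> PiE C V" if "v \<in> PiE C V" "c \<in> C" "x \<in> V c" for v c x
    using that by (auto simp: PiE_iff extensional_def)
  have g_in: "g v \<in> PiE C W" if "v \<in> PiE C V" for v
    using contra_hom_in[OF g] that by simp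
  have f: "\<forall>c\<in>C. f c \<in> V c \<rightarrow> W c"
    using PiE_mem[OF g_in[OF upd[OF v0]]] by (simp add: f_def)
  \<comment> \<open>\<open>v\<close> is the value of the contraaction on the functions that agree with \<open>v0\<close> off \<open>c\<close>.\<close>
  have "g v c = f c (v c)" if v: "v \<in> PiE C V" and c: "c \<in> C" for v c
  proof -
    let ?\<beta> = "\<lambda>a\<in>C. v0(a := v a)"
    have \<beta>: "?\<beta> \<in> C \<rightarrow>\<^sub>E PiE C V"
      using upd[OF v0] PiE_mem[OF v] by auto
    have "(\<lambda>a\<in>C. ?\<beta> a a) = v"
      using v by (auto simp: PiE_def extensional_def fun_eq_iff)
    \<comment> \<open>At index \<open>c\<close> the right-hand side only sees the entry of
      \<open>?\<beta>\<close> at \<open>c\<close>, hence depends on \<open>v\<close> through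
      \<open>v c\<close> alone.\<close>
    then have "g v = contraaction (prod_contra C W) (compose C g ?\<beta>)"
      using contra_hom_contraaction[OF g, of ?\<beta>] \<beta> by (simp cong: restrict_cong)
    moreover have "compose C g ?\<beta> \<in> C \<rightarrow>\<^sub>E PiE C W"
      using g_in PiE_mem[OF \<beta>] by (auto simp: compose_def)
    ultimately show ?thesis using c by (simp add: compose_def f_def)
  qed
  then have "g v = (\<lambda>c\<in>C. f c (v c))" if "v \<in> PiE C V" for v
    using g_in[OF that] that by (intro extensionalityI[of _ C]) (auto simp: PiE_def)
  then have "g = prod_map C V f"
    using g by (intro extensionalityI[of _ "PiE C V"]) (auto simp: prod_map_def contra_hom_def PiE_def)
  with f show ?thesis by (rule that)
qed

lemma prod_map_hom:
  assumes "\<forall>c\<in>C. f c \<in> V c \<rightarrow> W c"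
  shows "prod_map C V f \<in> contra_hom C (prod_contra C V) (prod_contra C W)"
proof -
  have *: "prod_map C V f v \<in> PiE C W" if "v \<in> PiE C V" for v
    using assms that PiE_mem[OF that] by (auto simp: prod_map_def)
  have "prod_map C V f (\<lambda>a\<in>C. \<beta> a a) =
      contraaction (prod_contra C W) (compose C (prod_map C V f) \<beta>)"
    if \<beta>: "\<beta> \<in> C \<rightarrow>\<^sub>E PiE C V" for \<beta>
  proof -
    have "compose C (prod_map C V f) \<beta> \<in> C \<rightarrow>\<^sub>E PiE C W"
      using * PiE_mem[OF \<beta>] by (auto simp: compose_def)
    moreover have "(\<lambda>a\<in>C. \<beta> a a) \<in> PiE C V"
      using PiE_mem[OF \<beta>] by (auto intro: PiE_mem)
    ultimately show ?thesis
      using PiE_mem[OF \<beta>] by (auto simp: prod_map_def compose_def intro!: restrict_ext)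
  qed
  then show ?thesis
    using * by (intro contra_homI) (simp_all add: prod_map_def)
qed

section \<open>The functor R\<close>

lemma comod_sectionsD:
  assumes "s \<in> comod_sections C X" "c \<in> C"
  shows "s c \<in> comod_carrier X" "snd (coaction X (s c)) = c"
  using assms by (auto simp: comod_sections_def dest: PiE_mem)

lemma comod_sections_ext: "s \<in> comod_sections C X \<Longrightarrow> s \<in> extensional C"
  by (auto simp: comod_sections_def PiE_def)

lemma comod_sections_restrict:
  "(\<And>c. c \<in> C \<Longrightarrow> s c \<in> comod_carrier X \<and> snd (coaction X (s c)) = c) \<Longrightarrow>
    (\<lambda>c\<in>C. s c) \<in> comod_sections C X"
  by (auto simp: comod_sections_def)

lemma diag_sections:
  assumes "\<beta> \<in> C \<rightarrow>\<^sub>E comod_sections C X"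
  shows "(\<lambda>a\<in>C. \<beta> a a) \<in> comod_sections C X"
  using comod_sectionsD[OF PiE_mem[OF assms]] by (intro comod_sections_restrict) blast

lemma R_ob_simps [simp]:
  "contra_carrier (R_ob C X) = comod_sections C X"
  "\<beta> \<in> C \<rightarrow>\<^sub>E comod_sections C X \<Longrightarrow> contraaction (R_ob C X) \<beta> = (\<lambda>a\<in>C. \<beta> a a)"
  by (simp_all add: R_ob_def)

lemma R_ob_contramodule: "is_contramodule C (R_ob C X)"
  unfolding R_ob_def using comod_sections_ext diag_sections by (intro diag_contramodule subsetI)

lemma compose_section:
  assumes "is_comodule C X" "is_comodule C Z" "f \<in> comod_hom X Z" "s \<in> comod_sections C X"
  shows "compose C f s \<in> comod_sections C Z"
  using assms(3) comod_sectionsD[OF assms(4)] unfolding compose_def comod_hom_iff[OF assms(1,2)]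
  by (intro comod_sections_restrict) (auto dest: PiE_mem)

lemma R_mor_hom:
  assumes "is_comodule C X" "is_comodule C Z" "f \<in> comod_hom X Z"
  shows "R_mor C X Z f \<in> contra_hom C (R_ob C X) (R_ob C Z)"
proof -
  have *: "R_mor C X Z f s = compose C f s" "R_mor C X Z f s \<in> comod_sections C Z"
    if "s \<in> comod_sections C X" for s
    using compose_section[OF assms that] that by (simp_all add: R_mor_def)
  have "R_mor C X Z f (\<lambda>a\<in>C. \<beta> a a) = contraaction (R_ob C Z) (compose C (R_mor C X Z f) \<beta>)"
    if \<beta>: "\<beta> \<in> C \<rightarrow>\<^sub>E comod_sections C X" for \<beta>
  proof -
    have "compose C (R_mor C X Z f) \<beta> \<in> C \<rightarrow>\<^sub>E comod_sections C Z"
      using *(2) PiE_mem[OF \<beta>] by (auto simp: compose_def)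
    then show ?thesis
      using *(1)[OF diag_sections[OF \<beta>]] *(1)[OF PiE_mem[OF \<beta>]]
      by (simp add: compose_def cong: restrict_cong)
  qed
  then show ?thesis
    using *(2) by (intro contra_homI) (simp_all add: R_mor_def)
qed

lemma R_functor:
  fixes C :: "'c set"
  shows "comod_to_contra_functor C (R_ob C :: ('c, 'x) comod \<Rightarrow> _) (R_mor C)"
  unfolding comod_to_contra_functor_def
proof (intro conjI allI impI ballI)
  fix X :: "('c, 'x) comod"
  show "is_contramodule C (R_ob C X)" by (rule R_ob_contramodule)
  show "R_mor C X X (comod_id X) = contra_id (R_ob C X)"
    unfolding R_mor_def contra_id_def R_ob_simps
  proof (rule restrict_ext)
    fix s assume s: "s \<in> comod_sections C X"
    then show "compose C (comod_id X) s = s"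
      using comod_sectionsD(1)[OF s] comod_sections_ext[OF s]
      by (intro extensionalityI[of _ C]) (auto simp: comod_id_def compose_def)
  qed
next
  fix X Z W :: "('c, 'x) comod" and f g
  assume *: "is_comodule C X" "is_comodule C Z" "is_comodule C W"
    "f \<in> comod_hom X Z" "g \<in> comod_hom Z W"
  show "R_mor C X W (compose (comod_carrier X) g f) =
      compose (contra_carrier (R_ob C X)) (R_mor C Z W g) (R_mor C X Z f)"
    using compose_section[OF *(1,2,4)] comod_sectionsD(1)[of _ C X]
    by (auto simp: R_mor_def compose_def intro!: restrict_ext)
qed (rule R_mor_hom)

text \<open>The first coordinate of a section at \<open>c\<close> is forced to be \<open>c\<close>,
  so the second coordinates determine it; the inverse puts the index back.\<close>

lemma R_canonical_iso:
  "contra_iso C (R_ob C (coprod_comod C U)) (prod_contra C U) (R_canonical C U)"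
proof (rule contra_iso_prod_contraI[OF R_ob_contramodule])
  let ?S = "comod_sections C (coprod_comod C U)"
  have s: "s c \<in> Sigma C U" "fst (s c) = c" "snd (s c) \<in> U c" if "s \<in> ?S" "c \<in> C" for s c
  proof -
    show "s c \<in> Sigma C U" using comod_sectionsD(1)[OF that] by simp
    then show "fst (s c) = c" using comod_sectionsD(2)[OF that] by simp
    then show "snd (s c) \<in> U c" using \<open>s c \<in> Sigma C U\<close> by (auto simp: mem_Sigma_iff)
  qed
  have can: "R_canonical C U s = (\<lambda>c\<in>C. snd (s c))" if "s \<in> ?S" for s
    using that by (simp add: R_canonical_def)
  have mk: "(\<lambda>c\<in>C. (c, u c)) \<in> ?S" if "u \<in> PiE C U" for u
    using PiE_mem[OF that] by (intro comod_sections_restrict) auto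
  have "bij_betw (R_canonical C U) ?S (PiE C U)"
  proof (rule bij_betw_byWitness[where f' = "\<lambda>u. \<lambda>c\<in>C. (c, u c)"])
    show "\<forall>x\<in>?S. (\<lambda>c\<in>C. (c, R_canonical C U x c)) = x"
    proof
      fix x assume x: "x \<in> ?S"
      show "(\<lambda>c\<in>C. (c, R_canonical C U x c)) = x"
        using s(2)[OF x] comod_sections_ext[OF x]
        by (intro extensionalityI[of _ C]) (simp_all add: can[OF x] prod_eq_iff)
    qed
    show "\<forall>u\<in>PiE C U. R_canonical C U (\<lambda>c\<in>C. (c, u c)) = u"
      by (auto simp: can[OF mk] extensional_def fun_eq_iff PiE_def)
    show "R_canonical C U ` ?S \<subseteq> PiE C U" using s(3) can by auto
    show "(\<lambda>u. \<lambda>c\<in>C. (c, u c)) ` PiE C U \<subseteq> ?S" using mk by blast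
  qed
  then show "bij_betw (R_canonical C U) (contra_carrier (R_ob C (coprod_comod C U))) (PiE C U)"
    by simp
  show "R_canonical C U (contraaction (R_ob C (coprod_comod C U)) \<beta>) a = R_canonical C U (\<beta> a) a"
    if \<beta>: "\<beta> \<in> C \<rightarrow>\<^sub>E contra_carrier (R_ob C (coprod_comod C U))" and a: "a \<in> C" for \<beta> a
    using can[OF diag_sections] can PiE_mem[OF \<beta> a] \<beta> a by simp
qed (simp add: R_canonical_def)

lemma R_coprod_to_prod:
  fixes C :: "'c set"
  shows "coprod_to_prod C (R_ob C) (R_mor C)
    (R_canonical C :: ('c \<Rightarrow> 'u set) \<Rightarrow> ('c \<Rightarrow> 'c \<times> 'u) \<Rightarrow> 'c \<Rightarrow> 'u)"
  unfolding coprod_to_prod_def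
proof (intro conjI allI impI R_canonical_iso)
  fix U W :: "'c \<Rightarrow> 'u set" and f
  assume f: "\<forall>c\<in>C. f c \<in> U c \<rightarrow> W c"
  let ?X = "coprod_comod C U" and ?Z = "coprod_comod C W"
  show "compose (contra_carrier (R_ob C ?X)) (prod_map C U f) (R_canonical C U) =
      compose (contra_carrier (R_ob C ?X)) (R_canonical C W) (R_mor C ?X ?Z (coprod_map C U f))"
    unfolding compose_def
  proof (rule restrict_ext)
    fix s assume "s \<in> contra_carrier (R_ob C ?X)"
    then have s: "s \<in> comod_sections C ?X" by simp
    have sc: "s c \<in> Sigma C U" "fst (s c) = c" "snd (s c) \<in> U c" if "c \<in> C" for c
      using comod_sectionsD[OF s that] by auto
    have "compose C (coprod_map C U f) s \<in> comod_sections C ?Z"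
      using compose_section[OF _ _ coprod_map_hom[OF f] s] by simp
    then show "prod_map C U f (R_canonical C U s) =
        R_canonical C W (R_mor C ?X ?Z (coprod_map C U f) s)"
      using s sc
      by (auto simp: prod_map_def R_canonical_def R_mor_def coprod_map_def compose_def
          intro!: restrict_ext)
  qed
qed

section \<open>The functor L\<close>

lemma equiv_coeq_rel: "equiv B (coeq_rel A B p q)"
  unfolding equiv_def refl_on_def sym_def trans_def coeq_rel_def
  by (auto intro: equivclp_sym equivclp_trans)

lemma coeq_rel_generator:
  "t \<in> A \<Longrightarrow> p t \<in> B \<Longrightarrow> q t \<in> B \<Longrightarrow> (p t, q t) \<in> coeq_rel A B p q"
  by (auto simp: coeq_rel_def intro!: r_into_equivclp)

text \<open>A map that coequalises \<open>p\<close> and \<open>q\<close> is constant along every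
  zigzag of generators; this is what lets it descend to the quotient.\<close>

lemma coeq_rel_eq:
  assumes "(x, y) \<in> coeq_rel A B p q" "\<And>t. t \<in> A \<Longrightarrow> h (p t) = h (q t)"
  shows "h x = h y"
proof -
  have "equivclp (\<lambda>u v. \<exists>t\<in>A. u = p t \<and> v = q t) x y"
    using assms(1) by (simp add: coeq_rel_def)
  then show ?thesis
    by (induction rule: equivclp_induct) (auto simp: assms(2))
qed

lemma the_elem_image_class:
  assumes "equiv B r" "x \<in> B" "\<And>y. (x, y) \<in> r \<Longrightarrow> h y = h x"
  shows "the_elem (h ` (r `` {x})) = h x"
proof -
  have "h ` (r `` {x}) = {h x}"
    using assms(3) equiv_class_self[OF assms(1,2)] by blast
  then show ?thesis by simp
qed

text \<open>The analogue of an elementary tensor: every element of \<open>L_carrier C Y\<close> has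
  this form, so maps out of it are computed on such classes.\<close>

definition L_class :: "'c set \<Rightarrow> ('c, 'y) contramod \<Rightarrow> 'y \<Rightarrow> 'c \<Rightarrow> ('y \<times> 'c) set" where
  "L_class C Y y a = L_rel C Y `` {(y, a)}"

lemma equiv_L_rel: "equiv (contra_carrier Y \<times> C) (L_rel C Y)"
  unfolding L_rel_def by (rule equiv_coeq_rel)

lemma L_carrier_class:
  "y \<in> contra_carrier Y \<Longrightarrow> a \<in> C \<Longrightarrow> L_class C Y y a \<in> L_carrier C Y"
  unfolding L_class_def L_carrier_def by (rule quotientI) auto

lemma L_carrierE:
  assumes "K \<in> L_carrier C Y"
  obtains y a where "y \<in> contra_carrier Y" "a \<in> C" "K = L_class C Y y a"
  using assms by (auto simp: L_carrier_def L_class_def elim!: quotientE)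

lemma L_class_contraaction:
  assumes "is_contramodule C Y" "\<beta> \<in> C \<rightarrow>\<^sub>E contra_carrier Y" "a \<in> C"
  shows "L_class C Y (contraaction Y \<beta>) a = L_class C Y (\<beta> a) a"
proof -
  have "((\<beta> a, a), (contraaction Y \<beta>, a)) \<in> L_rel C Y"
    unfolding L_rel_def using coeq_rel_generator[of "(\<beta>, a)" _ "\<lambda>(\<beta>, a). (\<beta> a, a)" _
        "\<lambda>(\<beta>, a). (contraaction Y \<beta>, a)"] contra_in[OF assms(1,2)] PiE_mem[OF assms(2,3)] assms
    by auto
  then show ?thesis
    unfolding L_class_def by (metis equiv_class_eq[OF equiv_L_rel])
qed

text \<open>The universal property of the coequaliser; it justifies \<open>the_elem\<close> in the
  coaction, in \<open>L_mor\<close> and in \<open>L_canonical\<close>.\<close>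

lemma L_universal:
  assumes "\<And>\<beta> a. \<beta> \<in> C \<rightarrow>\<^sub>E contra_carrier Y \<Longrightarrow> a \<in> C \<Longrightarrow> h (\<beta> a, a) = h (contraaction Y \<beta>, a)"
    and "y \<in> contra_carrier Y" "a \<in> C"
  shows "the_elem (h ` L_class C Y y a) = h (y, a)"
  unfolding L_class_def
proof (rule the_elem_image_class[OF equiv_L_rel])
  show "h x = h (y, a)" if "((y, a), x) \<in> L_rel C Y" for x
    using that unfolding L_rel_def by (rule coeq_rel_eq[THEN sym]) (use assms(1) in auto)
qed (use assms in auto)

lemma L_ob_simps [simp]: "comod_carrier (L_ob C Y) = L_carrier C Y"
  by (simp add: L_ob_def)

lemma L_coaction:
  "y \<in> contra_carrier Y \<Longrightarrow> a \<in> C \<Longrightarrow> coaction (L_ob C Y) (L_class C Y y a) = (L_class C Y y a, a)"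
  using L_universal[of C Y snd y a] by (simp add: L_ob_def L_carrier_class)

lemma L_ob_comodule: "is_comodule C (L_ob C Y)"
  unfolding is_comodule_iff
proof (intro conjI ballI)
  fix K assume "K \<in> comod_carrier (L_ob C Y)"
  then have "K \<in> L_carrier C Y" by simp
  then obtain y a where "y \<in> contra_carrier Y" "a \<in> C" "K = L_class C Y y a"
    by (rule L_carrierE)
  then show "fst (coaction (L_ob C Y) K) = K" "snd (coaction (L_ob C Y) K) \<in> C"
    by (auto simp: L_coaction)
qed (simp add: L_ob_def)

text \<open>Well defined because \<open>f\<close> turns \<open>contraaction Y \<beta>\<close> into
  the contraaction of \<open>compose C f \<beta>\<close>, which is glued at \<open>a\<close> to
  \<open>f (\<beta> a)\<close>.\<close>

lemma L_mor_class:
  assumes "is_contramodule C Y" "is_contramodule C Z" "f \<in> contra_hom C Y Z"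
    and "y \<in> contra_carrier Y" "a \<in> C"
  shows "L_mor C Y Z f (L_class C Y y a) = L_class C Z (f y) a"
proof -
  have "L_class C Z (f (\<beta> a)) a = L_class C Z (f (contraaction Y \<beta>)) a"
    if \<beta>: "\<beta> \<in> C \<rightarrow>\<^sub>E contra_carrier Y" and a: "a \<in> C" for \<beta> a
  proof -
    have "compose C f \<beta> \<in> C \<rightarrow>\<^sub>E contra_carrier Z"
      using contra_hom_in[OF assms(3)] PiE_mem[OF \<beta>] by (simp add: compose_def)
    from L_class_contraaction[OF assms(2) this a] show ?thesis
      using contra_hom_contraaction[OF assms(3) \<beta>] a by (simp add: compose_eq)
  qed
  then show ?thesis
    using L_universal[of C Y "\<lambda>(y, a). L_class C Z (f y) a" y a] assms(4,5)
    by (simp add: L_mor_def L_carrier_class L_class_def[of C Z])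
qed

lemma L_functor:
  fixes C :: "'c set"
  shows "contra_to_comod_functor C (L_ob C :: ('c, 'y) contramod \<Rightarrow> _) (L_mor C)"
  unfolding contra_to_comod_functor_def
proof (intro conjI allI impI ballI)
  fix Y :: "('c, 'y) contramod"
  show "is_comodule C (L_ob C Y)" by (rule L_ob_comodule)
next
  fix Y Z :: "('c, 'y) contramod" and f
  assume *: "is_contramodule C Y" "is_contramodule C Z" "f \<in> contra_hom C Y Z"
  have "L_mor C Y Z f K \<in> L_carrier C Z \<and>
      snd (coaction (L_ob C Z) (L_mor C Y Z f K)) = snd (coaction (L_ob C Y) K)"
    if "K \<in> L_carrier C Y" for K
    using that contra_hom_in[OF *(3)]
    by (elim L_carrierE) (simp add: L_mor_class[OF *] L_coaction L_carrier_class)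
  moreover have "L_mor C Y Z f \<in> extensional (L_carrier C Y)"
    by (simp add: L_mor_def)
  ultimately show "L_mor C Y Z f \<in> comod_hom (L_ob C Y) (L_ob C Z)"
    unfolding comod_hom_iff[OF L_ob_comodule L_ob_comodule] by (auto simp: PiE_iff)
next
  fix Y :: "('c, 'y) contramod"
  assume Y: "is_contramodule C Y"
  have "contra_id Y \<in> contra_hom C Y Y"
  proof (rule contra_homI)
    fix \<beta> assume \<beta>: "\<beta> \<in> C \<rightarrow>\<^sub>E contra_carrier Y"
    have "compose C (contra_id Y) \<beta> = \<beta>"
      using \<beta> PiE_mem[OF \<beta>]
      by (intro extensionalityI[of _ C]) (auto simp: contra_id_def compose_def PiE_def)
    then show "contra_id Y (contraaction Y \<beta>) = contraaction Y (compose C (contra_id Y) \<beta>)"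
      using contra_in[OF Y \<beta>] by (simp add: contra_id_def)
  qed (auto simp: contra_id_def)
  then have "L_mor C Y Y (contra_id Y) K = K" if "K \<in> L_carrier C Y" for K
    using that by (elim L_carrierE) (simp add: L_mor_class[OF Y Y] contra_id_def)
  then show "L_mor C Y Y (contra_id Y) = comod_id (L_ob C Y)"
    by (intro extensionalityI[of _ "L_carrier C Y"]) (auto simp: comod_id_def L_mor_def)
next
  fix Y Z W :: "('c, 'y) contramod" and f g
  assume *: "is_contramodule C Y" "is_contramodule C Z" "is_contramodule C W"
    "f \<in> contra_hom C Y Z" "g \<in> contra_hom C Z W"
  show "L_mor C Y W (compose (contra_carrier Y) g f) =
      compose (comod_carrier (L_ob C Y)) (L_mor C Z W g) (L_mor C Y Z f)" (is "?l = ?r")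
  proof (rule extensionalityI[of _ "L_carrier C Y"])
    show "?l K = ?r K" if "K \<in> L_carrier C Y" for K
      using that contra_hom_in[OF *(4)] contra_hom_compose[OF *(1,4,5)] *
      by (elim L_carrierE) (simp add: L_mor_class compose_eq L_carrier_class)
  qed (simp_all add: L_mor_def)
qed

section \<open>The value of L on products\<close>

lemma L_class_prod_eq:
  assumes "v \<in> PiE C V" "w \<in> PiE C V" "a \<in> C" "v a = w a"
  shows "L_class C (prod_contra C V) v a = L_class C (prod_contra C V) w a"
proof -
  \<comment> \<open>The function with value \<open>v\<close> at \<open>a\<close> and \<open>w\<close> elsewhere has contraaction \<open>w\<close>.\<close>
  let ?\<beta> = "\<lambda>b\<in>C. if b = a then v else w"
  have \<beta>: "?\<beta> \<in> C \<rightarrow>\<^sub>E PiE C V" using assms(1,2) by simp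
  have "(\<lambda>b\<in>C. ?\<beta> b b) = w"
    using assms by (intro extensionalityI[of _ C]) (auto simp: PiE_def)
  then show ?thesis
    using L_class_contraaction[of C "prod_contra C V" ?\<beta> a] \<beta> assms(3)
    by (simp cong: restrict_cong)
qed

text \<open>Evaluation respects the gluing, since in a product the contraaction of \<beta> and the
  family \<open>\<beta> a\<close> have the same value at \<open>a\<close>.\<close>

lemma L_canonical_class:
  assumes "v \<in> PiE C V" "a \<in> C"
  shows "L_canonical C V (L_class C (prod_contra C V) v a) = (a, v a)"
  using assms L_universal[of C "prod_contra C V" "\<lambda>(v, a). (a, v a)" v a]
  by (simp add: L_canonical_def L_carrier_class)

lemma L_canonical_iso:
  assumes V: "\<forall>c\<in>C. V c \<noteq> {}"
  shows "comod_iso C (L_ob C (prod_contra C V)) (coprod_comod C V) (L_canonical C V)"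
proof -
  let ?P = "prod_contra C V"
  have K: "L_canonical C V K \<in> Sigma C V \<and>
      snd (coaction (coprod_comod C V) (L_canonical C V K)) = snd (coaction (L_ob C ?P) K)"
    if "K \<in> L_carrier C ?P" for K
    using that by (elim L_carrierE) (auto simp: L_canonical_class L_coaction dest: PiE_mem)
  have "L_canonical C V \<in> extensional (L_carrier C ?P)"
    by (simp add: L_canonical_def)
  then have hom: "L_canonical C V \<in> comod_hom (L_ob C ?P) (coprod_comod C V)"
    unfolding comod_hom_iff[OF L_ob_comodule coprod_comod_comodule]
    using K by (simp only: PiE_iff L_ob_simps coprod_comod_simps(1)) blast
  have "inj_on (L_canonical C V) (L_carrier C ?P)"
  proof (rule inj_onI)
    fix K L assume "K \<in> L_carrier C ?P" "L \<in> L_carrier C ?P"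
      and eq: "L_canonical C V K = L_canonical C V L"
    then obtain v a w b where K: "v \<in> PiE C V" "a \<in> C" "K = L_class C ?P v a"
      and L: "w \<in> PiE C V" "b \<in> C" "L = L_class C ?P w b"
      by (auto elim!: L_carrierE)
    have "a = b" "v a = w a"
      using eq K L by (auto simp: L_canonical_class)
    then show "K = L"
      using L_class_prod_eq[of v C V w a] K L by simp
  qed
  moreover have "x \<in> L_canonical C V ` L_carrier C ?P" if x: "x \<in> Sigma C V" for x
  proof -
    obtain v0 where v0: "v0 \<in> PiE C V"
      using V by (metis PiE_eq_empty_iff ex_in_conv)
    \<comment> \<open>A point of one summand is hit only if it extends to a full family;
      \<open>v0\<close> supplies the other coordinates.\<close>
    let ?v = "v0(fst x := snd x)"
    have "?v \<in> PiE C V" using v0 x by (auto simp: PiE_iff extensional_def)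
    then show ?thesis
      using x L_canonical_class[of ?v C V "fst x"] L_carrier_class[of ?v ?P "fst x" C]
      by (intro image_eqI[of _ _ "L_class C ?P ?v (fst x)"]) auto
  qed
  ultimately have "bij_betw (L_canonical C V) (L_carrier C ?P) (Sigma C V)"
    using K unfolding bij_betw_def by blast
  then show ?thesis
    using hom by (simp add: comod_iso_iff L_ob_comodule)
qed

lemma L_prod_to_coprod:
  fixes C :: "'c set"
  shows "prod_to_coprod C (L_ob C) (L_mor C)
    (L_canonical C :: ('c \<Rightarrow> 'v set) \<Rightarrow> (('c \<Rightarrow> 'v) \<times> 'c) set \<Rightarrow> 'c \<times> 'v)"
  unfolding prod_to_coprod_def
proof (intro conjI allI impI L_canonical_iso)
  fix V W :: "'c \<Rightarrow> 'v set" and f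
  assume f: "\<forall>c\<in>C. f c \<in> V c \<rightarrow> W c"
  let ?V = "prod_contra C V" and ?W = "prod_contra C W"
  note hom = prod_map_hom[OF f]
  have "coprod_map C V f (L_canonical C V K) = L_canonical C W (L_mor C ?V ?W (prod_map C V f) K)"
    if "K \<in> L_carrier C ?V" for K
  proof -
    obtain v a where v: "v \<in> PiE C V" and a: "a \<in> C" and K: "K = L_class C ?V v a"
      using \<open>K \<in> L_carrier C ?V\<close> by (auto elim: L_carrierE)
    have "prod_map C V f v \<in> PiE C W" using contra_hom_in[OF hom] v by simp
    moreover have "L_mor C ?V ?W (prod_map C V f) K = L_class C ?W (prod_map C V f v) a"
      unfolding K by (rule L_mor_class[OF _ _ hom]) (use v a in simp_all)
    ultimately show ?thesis
      using v a PiE_mem[OF v a] by (simp add: K L_canonical_class coprod_map_def prod_map_def)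
  qed
  then show "compose (comod_carrier (L_ob C ?V)) (coprod_map C V f) (L_canonical C V) =
      compose (comod_carrier (L_ob C ?V)) (L_canonical C W) (L_mor C ?V ?W (prod_map C V f))"
    by (auto simp: compose_def intro!: restrict_ext)
qed

section \<open>Uniqueness of L and R\<close>

lemma contra_to_comod_functorD:
  assumes "contra_to_comod_functor C Fo Fm"
  shows "is_contramodule C Y \<Longrightarrow> is_comodule C (Fo Y)"
    and "is_contramodule C Y \<Longrightarrow> is_contramodule C Z \<Longrightarrow> f \<in> contra_hom C Y Z \<Longrightarrow>
      Fm Y Z f \<in> comod_hom (Fo Y) (Fo Z)"
    and "is_contramodule C Y \<Longrightarrow> Fm Y Y (contra_id Y) = comod_id (Fo Y)"
    and "is_contramodule C Y \<Longrightarrow> is_contramodule C Z \<Longrightarrow> is_contramodule C W \<Longrightarrow>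
      f \<in> contra_hom C Y Z \<Longrightarrow> g \<in> contra_hom C Z W \<Longrightarrow>
      Fm Y W (compose (contra_carrier Y) g f) = compose (comod_carrier (Fo Y)) (Fm Z W g) (Fm Y Z f)"
  using assms unfolding contra_to_comod_functor_def by blast+

lemma comod_to_contra_functorD:
  assumes "comod_to_contra_functor C Fo Fm"
  shows "is_comodule C X \<Longrightarrow> is_contramodule C (Fo X)"
    and "is_comodule C X \<Longrightarrow> is_comodule C Z \<Longrightarrow> f \<in> comod_hom X Z \<Longrightarrow>
      Fm X Z f \<in> contra_hom C (Fo X) (Fo Z)"
    and "is_comodule C X \<Longrightarrow> Fm X X (comod_id X) = contra_id (Fo X)"
    and "is_comodule C X \<Longrightarrow> is_comodule C Z \<Longrightarrow> is_comodule C W \<Longrightarrow>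
      f \<in> comod_hom X Z \<Longrightarrow> g \<in> comod_hom Z W \<Longrightarrow>
      Fm X W (compose (comod_carrier X) g f) = compose (contra_carrier (Fo X)) (Fm Z W g) (Fm X Z f)"
  using assms unfolding comod_to_contra_functor_def by blast+

lemma contra_to_comod_functor_iso:
  assumes F: "contra_to_comod_functor C Fo Fm" and f: "contra_iso C Y Z f"
  shows "comod_iso C (Fo Y) (Fo Z) (Fm Y Z f)"
proof -
  obtain g where Y: "is_contramodule C Y" and Z: "is_contramodule C Z"
    and f: "f \<in> contra_hom C Y Z" and g: "g \<in> contra_hom C Z Y"
    and gf: "compose (contra_carrier Y) g f = contra_id Y"
    and fg: "compose (contra_carrier Z) f g = contra_id Z"
    using f unfolding contra_iso_def by blast
  note D = contra_to_comod_functorD[OF F]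
  show ?thesis
    unfolding comod_iso_def
  proof (intro conjI bexI)
    show "compose (comod_carrier (Fo Y)) (Fm Z Y g) (Fm Y Z f) = comod_id (Fo Y)"
      using D(4)[OF Y Z Y f g] D(3)[OF Y] gf by simp
    show "compose (comod_carrier (Fo Z)) (Fm Y Z f) (Fm Z Y g) = comod_id (Fo Z)"
      using D(4)[OF Z Y Z g f] D(3)[OF Z] fg by simp
  qed (use D(1,2) Y Z f g in simp_all)
qed

lemma comod_to_contra_functor_iso:
  assumes F: "comod_to_contra_functor C Fo Fm" and f: "comod_iso C X Z f"
  shows "contra_iso C (Fo X) (Fo Z) (Fm X Z f)"
proof -
  obtain g where X: "is_comodule C X" and Z: "is_comodule C Z"
    and f: "f \<in> comod_hom X Z" and g: "g \<in> comod_hom Z X"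
    and gf: "compose (comod_carrier X) g f = comod_id X"
    and fg: "compose (comod_carrier Z) f g = comod_id Z"
    using f unfolding comod_iso_def by blast
  note D = comod_to_contra_functorD[OF F]
  show ?thesis
    unfolding contra_iso_def
  proof (intro conjI bexI)
    show "compose (contra_carrier (Fo X)) (Fm Z X g) (Fm X Z f) = contra_id (Fo X)"
      using D(4)[OF X Z X f g] D(3)[OF X] gf by simp
    show "compose (contra_carrier (Fo Z)) (Fm X Z f) (Fm Z X g) = contra_id (Fo Z)"
      using D(4)[OF Z X Z g f] D(3)[OF Z] fg by simp
  qed (use D(1,2) X Z f g in simp_all)
qed

lemma prod_to_coprodD:
  assumes "prod_to_coprod C Fo Fm \<alpha>" "\<forall>c\<in>C. V c \<noteq> {}"
  shows "comod_iso C (Fo (prod_contra C V)) (coprod_comod C V) (\<alpha> V)"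
    and "\<forall>c\<in>C. W c \<noteq> {} \<Longrightarrow> \<forall>c\<in>C. f c \<in> V c \<rightarrow> W c \<Longrightarrow> x \<in> comod_carrier (Fo (prod_contra C V)) \<Longrightarrow>
      coprod_map C V f (\<alpha> V x) =
      \<alpha> W (Fm (prod_contra C V) (prod_contra C W) (prod_map C V f) x)"
proof -
  show "comod_iso C (Fo (prod_contra C V)) (coprod_comod C V) (\<alpha> V)"
    using assms unfolding prod_to_coprod_def by blast
  assume W: "\<forall>c\<in>C. W c \<noteq> {}" "\<forall>c\<in>C. f c \<in> V c \<rightarrow> W c"
    and x: "x \<in> comod_carrier (Fo (prod_contra C V))"
  have "compose (comod_carrier (Fo (prod_contra C V))) (coprod_map C V f) (\<alpha> V) =
      compose (comod_carrier (Fo (prod_contra C V))) (\<alpha> W)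
        (Fm (prod_contra C V) (prod_contra C W) (prod_map C V f))"
    using assms W unfolding prod_to_coprod_def by blast
  from fun_cong[OF this, of x] x
  show "coprod_map C V f (\<alpha> V x) =
      \<alpha> W (Fm (prod_contra C V) (prod_contra C W) (prod_map C V f) x)"
    by (simp add: compose_eq)
qed

lemma coprod_to_prodD:
  assumes "coprod_to_prod C Fo Fm \<alpha>"
  shows "contra_iso C (Fo (coprod_comod C U)) (prod_contra C U) (\<alpha> U)"
    and "\<forall>c\<in>C. f c \<in> U c \<rightarrow> W c \<Longrightarrow> x \<in> contra_carrier (Fo (coprod_comod C U)) \<Longrightarrow>
      prod_map C U f (\<alpha> U x) =
      \<alpha> W (Fm (coprod_comod C U) (coprod_comod C W) (coprod_map C U f) x)"
proof -
  show "contra_iso C (Fo (coprod_comod C U)) (prod_contra C U) (\<alpha> U)"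
    using assms unfolding coprod_to_prod_def by blast
  assume W: "\<forall>c\<in>C. f c \<in> U c \<rightarrow> W c" and x: "x \<in> contra_carrier (Fo (coprod_comod C U))"
  have "compose (contra_carrier (Fo (coprod_comod C U))) (prod_map C U f) (\<alpha> U) =
      compose (contra_carrier (Fo (coprod_comod C U))) (\<alpha> W)
        (Fm (coprod_comod C U) (coprod_comod C W) (coprod_map C U f))"
    using assms W unfolding coprod_to_prod_def by blast
  from fun_cong[OF this, of x] x
  show "prod_map C U f (\<alpha> U x) =
      \<alpha> W (Fm (coprod_comod C U) (coprod_comod C W) (coprod_map C U f) x)"
    by (simp add: compose_eq)
qed

section \<open>Transport of arbitrary morphisms to products and coproducts\<close>

lemma contra_hom_conjugate:
  assumes d: "contra_iso C Y (prod_contra C V) d" and e: "contra_iso C Z (prod_contra C W) e"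
    and V: "\<forall>c\<in>C. V c \<noteq> {}" and f: "f \<in> contra_hom C Y Z"
  obtains g where "\<forall>c\<in>C. g c \<in> V c \<rightarrow> W c"
    "compose (contra_carrier Y) (prod_map C V g) d = compose (contra_carrier Y) e f"
proof -
  let ?k = "compose (PiE C V) (compose (contra_carrier Y) e f)
    (restrict (inv_into (contra_carrier Y) d) (PiE C V))"
  have "restrict (inv_into (contra_carrier Y) d) (PiE C V) \<in> contra_hom C (prod_contra C V) Y"
    using contra_iso_inv[OF d] by (simp add: contra_iso_iff)
  moreover have "compose (contra_carrier Y) e f \<in> contra_hom C Y (prod_contra C W)"
    using contra_hom_compose[OF _ f, of e] d e by (simp add: contra_iso_iff)
  ultimately have "?k \<in> contra_hom C (prod_contra C V) (prod_contra C W)"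
    using contra_hom_compose[of C "prod_contra C V"] by simp
  then obtain g where g: "\<forall>c\<in>C. g c \<in> V c \<rightarrow> W c" "?k = prod_map C V g"
    using prod_hom_eq_prod_map[OF V] by blast
  have d_in: "d y \<in> PiE C V" "inv_into (contra_carrier Y) d (d y) = y" if "y \<in> contra_carrier Y" for y
    using d that by (auto simp: contra_iso_iff bij_betw_def)
  have "compose (contra_carrier Y) (prod_map C V g) d = compose (contra_carrier Y) e f"
    unfolding g(2)[symmetric] using d_in by (auto simp: compose_def intro!: restrict_ext)
  with g(1) show ?thesis by (rule that)
qed

lemma comod_hom_conjugate:
  assumes d: "comod_iso C X (coprod_comod C U) d" and e: "comod_iso C Z (coprod_comod C W) e"
    and f: "f \<in> comod_hom X Z"
  obtains g where "\<forall>c\<in>C. g c \<in> U c \<rightarrow> W c"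
    "compose (comod_carrier X) (coprod_map C U g) d = compose (comod_carrier X) e f"
proof -
  let ?k = "compose (Sigma C U) (compose (comod_carrier X) e f)
    (restrict (inv_into (comod_carrier X) d) (Sigma C U))"
  have "restrict (inv_into (comod_carrier X) d) (Sigma C U) \<in> comod_hom (coprod_comod C U) X"
    using comod_iso_inv[OF d] by (simp add: comod_iso_iff)
  moreover have "compose (comod_carrier X) e f \<in> comod_hom X (coprod_comod C W)"
    using comod_hom_compose[OF _ _ _ f, where C = C and g = e] d e by (simp add: comod_iso_iff)
  ultimately have "?k \<in> comod_hom (coprod_comod C U) (coprod_comod C W)"
    using comod_hom_compose[of C "coprod_comod C U" X "coprod_comod C W"] d
    by (simp add: comod_iso_iff)
  then obtain g where g: "\<forall>c\<in>C. g c \<in> U c \<rightarrow> W c" "?k = coprod_map C U g"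
    using coprod_hom_eq_coprod_map by blast
  have d_in: "d x \<in> Sigma C U" "inv_into (comod_carrier X) d (d x) = x" if "x \<in> comod_carrier X" for x
    using d that by (auto simp: comod_iso_iff bij_betw_def)
  have "compose (comod_carrier X) (coprod_map C U g) d = compose (comod_carrier X) e f"
    unfolding g(2)[symmetric] using d_in by (auto simp: compose_def intro!: restrict_ext)
  with g(1) show ?thesis by (rule that)
qed

text \<open>The functor sends the square relating \<open>f\<close> to \<open>prod_map C V g\<close>
  to a square of comodules, and naturality of \<alpha> for \<open>prod_map C V g\<close> is pasted
  onto it. Thus \<alpha> becomes natural for all morphisms between objects identified with non-empty
  products.\<close>

lemma prod_to_coprod_conjugate:
  assumes F: "contra_to_comod_functor C Fo Fm" and \<alpha>: "prod_to_coprod C Fo Fm \<alpha>"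
    and d: "contra_iso C Y (prod_contra C V) d" and e: "contra_iso C Z (prod_contra C W) e"
    and V: "\<forall>c\<in>C. V c \<noteq> {}" and W: "\<forall>c\<in>C. W c \<noteq> {}" and f: "f \<in> contra_hom C Y Z"
    and g: "\<forall>c\<in>C. g c \<in> V c \<rightarrow> W c"
      "compose (contra_carrier Y) (prod_map C V g) d = compose (contra_carrier Y) e f"
    and x: "x \<in> comod_carrier (Fo Y)"
  shows "coprod_map C V g (\<alpha> V (Fm Y (prod_contra C V) d x)) =
    \<alpha> W (Fm Z (prod_contra C W) e (Fm Y Z f x))"
proof -
  let ?V = "prod_contra C V" and ?W = "prod_contra C W"
  note D = contra_to_comod_functorD[OF F]
  have Y: "is_contramodule C Y" and Z: "is_contramodule C Z"
    and d': "d \<in> contra_hom C Y ?V" and e': "e \<in> contra_hom C Z ?W"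
    using d e by (auto simp: contra_iso_iff)
  have "Fm Y ?V d x \<in> comod_carrier (Fo ?V)"
    using comod_hom_in[OF D(2)[OF Y _ d']] x by simp
  then have "coprod_map C V g (\<alpha> V (Fm Y ?V d x)) =
      \<alpha> W (Fm ?V ?W (prod_map C V g) (Fm Y ?V d x))"
    by (rule prod_to_coprodD(2)[OF \<alpha> V W g(1)])
  also have "Fm ?V ?W (prod_map C V g) (Fm Y ?V d x) =
      Fm Y ?W (compose (contra_carrier Y) (prod_map C V g) d) x"
    using D(4)[OF Y _ _ d' prod_map_hom[OF g(1)]] x by (simp add: compose_eq)
  also have "\<dots> = Fm Z ?W e (Fm Y Z f x)"
    unfolding g(2) using D(4)[OF Y Z _ f e'] x by (simp add: compose_eq)
  finally show ?thesis .
qed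

lemma coprod_to_prod_conjugate:
  assumes F: "comod_to_contra_functor C Fo Fm" and \<alpha>: "coprod_to_prod C Fo Fm \<alpha>"
    and d: "comod_iso C X (coprod_comod C U) d" and e: "comod_iso C Z (coprod_comod C W) e"
    and f: "f \<in> comod_hom X Z"
    and g: "\<forall>c\<in>C. g c \<in> U c \<rightarrow> W c"
      "compose (comod_carrier X) (coprod_map C U g) d = compose (comod_carrier X) e f"
    and x: "x \<in> contra_carrier (Fo X)"
  shows "prod_map C U g (\<alpha> U (Fm X (coprod_comod C U) d x)) =
    \<alpha> W (Fm Z (coprod_comod C W) e (Fm X Z f x))"
proof -
  let ?U = "coprod_comod C U" and ?W = "coprod_comod C W"
  note D = comod_to_contra_functorD[OF F]
  have X: "is_comodule C X" and Z: "is_comodule C Z"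
    and d': "d \<in> comod_hom X ?U" and e': "e \<in> comod_hom Z ?W"
    using d e by (auto simp: comod_iso_iff)
  have "Fm X ?U d x \<in> contra_carrier (Fo ?U)"
    using contra_hom_in[OF D(2)[OF X _ d']] x by simp
  then have "prod_map C U g (\<alpha> U (Fm X ?U d x)) =
      \<alpha> W (Fm ?U ?W (coprod_map C U g) (Fm X ?U d x))"
    by (rule coprod_to_prodD(2)[OF \<alpha> g(1)])
  also have "Fm ?U ?W (coprod_map C U g) (Fm X ?U d x) =
      Fm X ?W (compose (comod_carrier X) (coprod_map C U g) d) x"
    using D(4)[OF X _ _ d' coprod_map_hom[OF g(1)]] x by (simp add: compose_eq)
  also have "\<dots> = Fm Z ?W e (Fm X Z f x)"
    unfolding g(2) using D(4)[OF X Z _ f e'] x by (simp add: compose_eq)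
  finally show ?thesis .
qed

section \<open>The value on the empty contramodule\<close>

lemma empty_contramodule_index:
  assumes "is_contramodule C Y" "contra_carrier Y = {}"
  shows "C \<noteq> {}"
  using contra_in[OF assms(1), of "\<lambda>_. undefined"] assms(2) by auto

text \<open>
  The two constant self-maps of the product of copies of \<open>'v\<close> agree after the map from the empty
  contramodule, but \<open>Fo\<close> turns them into maps without a common value.
\<close>

lemma prod_to_coprod_empty:
  fixes Fo :: "('c, 'c \<Rightarrow> 'v) contramod \<Rightarrow> ('c, 'p) comod"
  assumes F: "contra_to_comod_functor C Fo Fm" and \<alpha>: "prod_to_coprod C Fo Fm \<alpha>"
    and Y: "is_contramodule C Y" "contra_carrier Y = {}" and two: "\<exists>v w :: 'v. v \<noteq> w"
  shows "comod_carrier (Fo Y) = {}"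
proof (rule ccontr)
  assume "comod_carrier (Fo Y) \<noteq> {}"
  then obtain x where x: "x \<in> comod_carrier (Fo Y)" by blast
  obtain v w :: 'v where "v \<noteq> w" using two by blast
  define V :: "'c \<Rightarrow> 'v set" where "V = (\<lambda>_. UNIV)"
  let ?P = "prod_contra C V" and ?i = "\<lambda>_. undefined"
  note D = contra_to_comod_functorD[OF F]
  \<comment> \<open>As \<open>C\<close> has an element, there is no function from \<open>C\<close>
    to the empty carrier, so the morphism condition is vacuous.\<close>
  have i: "?i \<in> contra_hom C Y ?P"
    using empty_contramodule_index[OF Y] Y(2) by (intro contra_homI) auto
  let ?z = "Fm Y ?P ?i x"
  have z: "?z \<in> comod_carrier (Fo ?P)"
    using comod_hom_in[OF D(2)[OF Y(1) _ i] x] by simp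
  \<comment> \<open>Replacing the second coordinate of \<open>\<alpha> V ?z\<close> by any
    \<open>u\<close> leaves it unchanged, which is absurd once the type has two elements. Taking
    \<open>UNIV\<close> for every factor makes all constant maps available.\<close>
  have eq: "coprod_map C V (\<lambda>_ _. u) (\<alpha> V ?z) = \<alpha> V (Fm Y ?P ?i x)" for u
  proof -
    have u: "\<forall>c\<in>C. (\<lambda>_. u) \<in> V c \<rightarrow> V c" by (simp add: V_def)
    have "compose (contra_carrier Y) (prod_map C V (\<lambda>_ _. u)) ?i = ?i"
      using Y(2) by (simp add: compose_def restrict_def)
    then have "Fm ?P ?P (prod_map C V (\<lambda>_ _. u)) ?z = Fm Y ?P ?i x"
      using fun_cong[OF D(4)[OF Y(1) _ _ i prod_map_hom[OF u]], of x] x by (simp add: compose_eq)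
    then show ?thesis
      using prod_to_coprodD(2)[OF \<alpha> _ _ u z] by (simp add: V_def)
  qed
  have "\<alpha> V ?z \<in> Sigma C V"
    using prod_to_coprodD(1)[OF \<alpha>, of V] z comod_hom_in[of "\<alpha> V" "Fo ?P" "coprod_comod C V" ?z]
    by (simp add: comod_iso_iff V_def)
  then have "coprod_map C V (\<lambda>_ _. u) (\<alpha> V ?z) = (fst (\<alpha> V ?z), u)" for u
    by (simp add: coprod_map_def)
  with eq have "(fst (\<alpha> V ?z), v) = (fst (\<alpha> V ?z), w)" by metis
  then show False using \<open>v \<noteq> w\<close> by simp
qed

lemma empty_comod_iso:
  assumes "is_comodule C X" "is_comodule C Z" "comod_carrier X = {}" "comod_carrier Z = {}"
  shows "comod_iso C X Z (\<lambda>_. undefined)"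
  using assms by (simp add: comod_iso_iff comod_hom_def bij_betw_def)

section \<open>Comparison of two functors given by the same formulas\<close>

lemma product_contramodule_nonempty:
  assumes "Y \<in> product_contramodules C TYPE('v)" "contra_carrier Y \<noteq> {}"
  shows "\<exists>(V :: 'c \<Rightarrow> 'v set) e. (\<forall>c\<in>C. V c \<noteq> {}) \<and> contra_iso C Y (prod_contra C V) e"
proof -
  obtain V :: "'c \<Rightarrow> 'v set" and e where e: "contra_iso C Y (prod_contra C V) e"
    using assms(1) by (auto simp: product_contramodules_def contra_isomorphic_def)
  then have "PiE C V \<noteq> {}"
    using assms(2) by (auto simp: contra_iso_iff bij_betw_def)
  then have "\<forall>c\<in>C. V c \<noteq> {}"
    by (simp add: PiE_eq_empty_iff)
  with e show ?thesis by blast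
qed

text \<open>The same identification \<open>e Y\<close> of a non-empty \<open>Y\<close> with a
  product is used for both functors: \<sigma> and \<tau> then compare them with one coproduct, and
  \<eta> is \<sigma> followed by the inverse of \<tau>.\<close>

lemma prod_to_coprod_unique:
  fixes Fo :: "('c, 'c \<Rightarrow> 'v) contramod \<Rightarrow> ('c, 'p) comod"
    and Go :: "('c, 'c \<Rightarrow> 'v) contramod \<Rightarrow> ('c, 'q) comod"
  assumes F: "contra_to_comod_functor C Fo Fm" "prod_to_coprod C Fo Fm \<alpha>"
    and G: "contra_to_comod_functor C Go Gm" "prod_to_coprod C Go Gm \<beta>"
    and two: "\<exists>v w :: 'v. v \<noteq> w"
  shows "\<exists>\<eta>. contra_to_comod_nat_iso C (product_contramodules C TYPE('v)) Fo Fm Go Gm \<eta>"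
proof -
  let ?Obs = "product_contramodules C TYPE('v)"
  obtain V :: "('c, 'c \<Rightarrow> 'v) contramod \<Rightarrow> 'c \<Rightarrow> 'v set" and e where
    V: "\<And>Y c. Y \<in> ?Obs \<Longrightarrow> contra_carrier Y \<noteq> {} \<Longrightarrow> \<forall>c\<in>C. V Y c \<noteq> {}"
    and e: "\<And>Y. Y \<in> ?Obs \<Longrightarrow> contra_carrier Y \<noteq> {} \<Longrightarrow> contra_iso C Y (prod_contra C (V Y)) (e Y)"
    using product_contramodule_nonempty[of _ C] by metis
  define \<sigma> where "\<sigma> Y = compose (comod_carrier (Fo Y)) (\<alpha> (V Y)) (Fm Y (prod_contra C (V Y)) (e Y))" for Y
  define \<tau> where "\<tau> Y = compose (comod_carrier (Go Y)) (\<beta> (V Y)) (Gm Y (prod_contra C (V Y)) (e Y))" for Y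
  define \<eta> where "\<eta> Y = (if contra_carrier Y = {} then \<lambda>_. undefined
    else compose (comod_carrier (Fo Y)) (restrict (inv_into (comod_carrier (Go Y)) (\<tau> Y)) (Sigma C (V Y))) (\<sigma> Y))"
    for Y
  have obs: "is_contramodule C Y" if "Y \<in> ?Obs" for Y
    using that by (simp add: product_contramodules_def)
  have empty: "comod_carrier (Fo Y) = {}" "comod_carrier (Go Y) = {}"
    if "Y \<in> ?Obs" "contra_carrier Y = {}" for Y
    using prod_to_coprod_empty[OF F obs[OF that(1)] that(2) two]
      prod_to_coprod_empty[OF G obs[OF that(1)] that(2) two] by auto
  have \<sigma>: "comod_iso C (Fo Y) (coprod_comod C (V Y)) (\<sigma> Y)"
    and \<tau>: "comod_iso C (Go Y) (coprod_comod C (V Y)) (\<tau> Y)"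
    if "Y \<in> ?Obs" "contra_carrier Y \<noteq> {}" for Y
    using comod_iso_compose[OF contra_to_comod_functor_iso[OF F(1) e[OF that]]
        prod_to_coprodD(1)[OF F(2) V[OF that]]]
      comod_iso_compose[OF contra_to_comod_functor_iso[OF G(1) e[OF that]]
        prod_to_coprodD(1)[OF G(2) V[OF that]]]
    unfolding \<sigma>_def \<tau>_def .
  have \<eta>: "comod_iso C (Fo Y) (Go Y) (\<eta> Y)" if "Y \<in> ?Obs" for Y
  proof (cases "contra_carrier Y = {}")
    case True
    then show ?thesis
      using empty_comod_iso[of C "Fo Y" "Go Y"] empty[OF that True] obs[OF that]
        contra_to_comod_functorD(1)[OF F(1)] contra_to_comod_functorD(1)[OF G(1)]
      by (simp add: \<eta>_def)
  next
    case False
    then show ?thesis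
      using comod_iso_compose[OF \<sigma> comod_iso_inv[OF \<tau>]] that by (simp add: \<eta>_def)
  qed
  have \<eta>_in: "\<eta> Y x \<in> comod_carrier (Go Y)" if "Y \<in> ?Obs" "x \<in> comod_carrier (Fo Y)" for Y x
    using \<eta>[OF that(1)] comod_hom_in that(2) by (auto simp: comod_iso_iff)
  have \<tau>\<eta>: "\<tau> Y (\<eta> Y x) = \<sigma> Y x" if Y: "Y \<in> ?Obs" and x: "x \<in> comod_carrier (Fo Y)" for Y x
  proof -
    have ne: "contra_carrier Y \<noteq> {}" using empty(1)[OF Y] x by auto
    have "\<sigma> Y x \<in> Sigma C (V Y)" "\<tau> Y ` comod_carrier (Go Y) = Sigma C (V Y)"
      using \<sigma>[OF Y ne] \<tau>[OF Y ne] x by (auto simp: comod_iso_iff bij_betw_def)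
    then show ?thesis
      using ne x by (simp add: \<eta>_def compose_eq f_inv_into_f)
  qed
  have "Gm Y Z f (\<eta> Y x) = \<eta> Z (Fm Y Z f x)"
    if Y: "Y \<in> ?Obs" and Z: "Z \<in> ?Obs" and f: "f \<in> contra_hom C Y Z"
      and x: "x \<in> comod_carrier (Fo Y)" for Y Z f x
  proof -
    \<comment> \<open>An element of \<open>Fo Y\<close> excludes the empty contramodule, so
      naturality squares starting there hold vacuously.\<close>
    have neY: "contra_carrier Y \<noteq> {}" using empty(1)[OF Y] x by auto
    then have neZ: "contra_carrier Z \<noteq> {}" using contra_hom_in[OF f] by blast
    obtain g where g: "\<forall>c\<in>C. g c \<in> V Y c \<rightarrow> V Z c"
      "compose (contra_carrier Y) (prod_map C (V Y) g) (e Y) = compose (contra_carrier Y) (e Z) f"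
      using contra_hom_conjugate[OF e[OF Y neY] e[OF Z neZ] V[OF Y neY] f] .
    \<comment> \<open>The functor is left open: \<open>g\<close> depends only on \<open>f\<close>
      and the identifications, so one \<open>g\<close> describes the action of both functors on
      \<open>f\<close>.\<close>
    note conj = prod_to_coprod_conjugate[OF _ _ e[OF Y neY] e[OF Z neZ] V[OF Y neY] V[OF Z neZ] f g]
    have Fx: "Fm Y Z f x \<in> comod_carrier (Fo Z)"
      using comod_hom_in[OF contra_to_comod_functorD(2)[OF F(1) obs[OF Y] obs[OF Z] f] x] .
    have G\<eta>: "Gm Y Z f (\<eta> Y x) \<in> comod_carrier (Go Z)"
      using comod_hom_in[OF contra_to_comod_functorD(2)[OF G(1) obs[OF Y] obs[OF Z] f] \<eta>_in[OF Y x]] .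
    \<comment> \<open>The two sides are compared after the injective map \<open>\<tau> Z\<close>,
      where both become the image of \<open>\<sigma> Y x\<close> under
      \<open>coprod_map C (V Y) g\<close>.\<close>
    have "\<tau> Z (\<eta> Z (Fm Y Z f x)) = \<sigma> Z (Fm Y Z f x)"
      by (rule \<tau>\<eta>[OF Z Fx])
    also have "\<dots> = coprod_map C (V Y) g (\<sigma> Y x)"
      using conj[OF F x] x Fx by (simp add: \<sigma>_def compose_eq)
    also have "\<dots> = coprod_map C (V Y) g (\<tau> Y (\<eta> Y x))"
      by (simp add: \<tau>\<eta>[OF Y x])
    also have "\<dots> = \<tau> Z (Gm Y Z f (\<eta> Y x))"
      using conj[OF G \<eta>_in[OF Y x]] \<eta>_in[OF Y x] G\<eta> by (simp add: \<tau>_def compose_eq)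
    finally have "\<tau> Z (\<eta> Z (Fm Y Z f x)) = \<tau> Z (Gm Y Z f (\<eta> Y x))" .
    then show ?thesis
      using \<tau>[OF Z neZ] G\<eta> \<eta>_in[OF Z Fx] by (simp add: comod_iso_iff bij_betw_def inj_on_def)
  qed
  then have "contra_to_comod_nat_iso C ?Obs Fo Fm Go Gm \<eta>"
    unfolding contra_to_comod_nat_iso_def using \<eta> by (auto simp: compose_def intro!: restrict_ext)
  then show ?thesis by (rule exI[of _ \<eta>])
qed

lemma coprod_to_prod_unique:
  fixes Fo :: "('c, 'c \<times> 'u) comod \<Rightarrow> ('c, 'p) contramod"
    and Go :: "('c, 'c \<times> 'u) comod \<Rightarrow> ('c, 'q) contramod"
  assumes F: "comod_to_contra_functor C Fo Fm" "coprod_to_prod C Fo Fm \<alpha>"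
    and G: "comod_to_contra_functor C Go Gm" "coprod_to_prod C Go Gm \<beta>"
  shows "\<exists>\<eta>. comod_to_contra_nat_iso C (coproduct_comodules C TYPE('u)) Fo Fm Go Gm \<eta>"
proof -
  let ?Obs = "coproduct_comodules C TYPE('u)"
  have "\<forall>X\<in>?Obs. \<exists>(U :: 'c \<Rightarrow> 'u set) e. comod_iso C X (coprod_comod C U) e"
    by (auto simp: coproduct_comodules_def comod_isomorphic_def)
  then obtain U :: "('c, 'c \<times> 'u) comod \<Rightarrow> 'c \<Rightarrow> 'u set" and e where
    e: "\<And>X. X \<in> ?Obs \<Longrightarrow> comod_iso C X (coprod_comod C (U X)) (e X)"
    by metis
  define \<sigma> where "\<sigma> X = compose (contra_carrier (Fo X)) (\<alpha> (U X)) (Fm X (coprod_comod C (U X)) (e X))" for X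
  define \<tau> where "\<tau> X = compose (contra_carrier (Go X)) (\<beta> (U X)) (Gm X (coprod_comod C (U X)) (e X))" for X
  define \<eta> where "\<eta> X = compose (contra_carrier (Fo X))
    (restrict (inv_into (contra_carrier (Go X)) (\<tau> X)) (PiE C (U X))) (\<sigma> X)" for X
  have obs: "is_comodule C X" if "X \<in> ?Obs" for X
    using that by (simp add: coproduct_comodules_def)
  have \<sigma>: "contra_iso C (Fo X) (prod_contra C (U X)) (\<sigma> X)"
    and \<tau>: "contra_iso C (Go X) (prod_contra C (U X)) (\<tau> X)" if "X \<in> ?Obs" for X
    using contra_iso_compose[OF comod_to_contra_functor_iso[OF F(1) e[OF that]]
        coprod_to_prodD(1)[OF F(2)]]
      contra_iso_compose[OF comod_to_contra_functor_iso[OF G(1) e[OF that]]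
        coprod_to_prodD(1)[OF G(2)]]
    unfolding \<sigma>_def \<tau>_def .
  have \<eta>: "contra_iso C (Fo X) (Go X) (\<eta> X)" if "X \<in> ?Obs" for X
    using contra_iso_compose[OF \<sigma> contra_iso_inv[OF \<tau>]] that by (simp add: \<eta>_def)
  have \<eta>_in: "\<eta> X x \<in> contra_carrier (Go X)" if "X \<in> ?Obs" "x \<in> contra_carrier (Fo X)" for X x
    using \<eta>[OF that(1)] contra_hom_in that(2) by (auto simp: contra_iso_iff)
  have \<tau>\<eta>: "\<tau> X (\<eta> X x) = \<sigma> X x" if X: "X \<in> ?Obs" and x: "x \<in> contra_carrier (Fo X)" for X x
  proof -
    have "\<sigma> X x \<in> PiE C (U X)" "\<tau> X ` contra_carrier (Go X) = PiE C (U X)"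
      using \<sigma>[OF X] \<tau>[OF X] x by (auto simp: contra_iso_iff bij_betw_def)
    then show ?thesis
      using x by (simp add: \<eta>_def compose_eq f_inv_into_f)
  qed
  have "Gm X Z f (\<eta> X x) = \<eta> Z (Fm X Z f x)"
    if X: "X \<in> ?Obs" and Z: "Z \<in> ?Obs" and f: "f \<in> comod_hom X Z"
      and x: "x \<in> contra_carrier (Fo X)" for X Z f x
  proof -
    obtain g where g: "\<forall>c\<in>C. g c \<in> U X c \<rightarrow> U Z c"
      "compose (comod_carrier X) (coprod_map C (U X) g) (e X) = compose (comod_carrier X) (e Z) f"
      using comod_hom_conjugate[OF e[OF X] e[OF Z] f] .
    note conj = coprod_to_prod_conjugate[OF _ _ e[OF X] e[OF Z] f g]
    have Fx: "Fm X Z f x \<in> contra_carrier (Fo Z)"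
      using contra_hom_in[OF comod_to_contra_functorD(2)[OF F(1) obs[OF X] obs[OF Z] f] x] .
    have G\<eta>: "Gm X Z f (\<eta> X x) \<in> contra_carrier (Go Z)"
      using contra_hom_in[OF comod_to_contra_functorD(2)[OF G(1) obs[OF X] obs[OF Z] f] \<eta>_in[OF X x]] .
    have "\<tau> Z (\<eta> Z (Fm X Z f x)) = \<sigma> Z (Fm X Z f x)"
      by (rule \<tau>\<eta>[OF Z Fx])
    also have "\<dots> = prod_map C (U X) g (\<sigma> X x)"
      using conj[OF F x] x Fx by (simp add: \<sigma>_def compose_eq)
    also have "\<dots> = prod_map C (U X) g (\<tau> X (\<eta> X x))"
      by (simp add: \<tau>\<eta>[OF X x])
    also have "\<dots> = \<tau> Z (Gm X Z f (\<eta> X x))"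
      using conj[OF G \<eta>_in[OF X x]] \<eta>_in[OF X x] G\<eta> by (simp add: \<tau>_def compose_eq)
    finally have "\<tau> Z (\<eta> Z (Fm X Z f x)) = \<tau> Z (Gm X Z f (\<eta> X x))" .
    then show ?thesis
      using \<tau>[OF Z] G\<eta> \<eta>_in[OF Z Fx] by (simp add: contra_iso_iff bij_betw_def inj_on_def)
  qed
  then have "comod_to_contra_nat_iso C ?Obs Fo Fm Go Gm \<eta>"
    unfolding comod_to_contra_nat_iso_def using \<eta> by (auto simp: compose_def intro!: restrict_ext)
  then show ?thesis by (rule exI[of _ \<eta>])
qed

theorem theorem2:
  fixes C :: "'c set"
  shows
    \<comment> \<open>(1)\<close>
    "(\<forall>X :: ('c, 'x) comod. is_comodule C X \<longrightarrow>
        (\<exists>U :: 'c \<Rightarrow> 'x set. comod_isomorphic C X (coprod_comod C U))) \<and>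
    \<comment> \<open>(2)\<close>
     (\<forall>Y :: ('c, 'y) contramod. is_contramodule C Y \<longrightarrow>
        (\<exists>V :: 'c \<Rightarrow> 'y set. contra_isomorphic C Y (prod_contra C V))) \<and>
    \<comment> \<open>(3): L and R are functors, given by the formulas\<close>
     contra_to_comod_functor C (L_ob C :: ('c, 'y) contramod \<Rightarrow> _) (L_mor C) \<and>
     comod_to_contra_functor C (R_ob C :: ('c, 'x) comod \<Rightarrow> _) (R_mor C) \<and>
     prod_to_coprod C (L_ob C) (L_mor C)
       (L_canonical C :: ('c \<Rightarrow> 'v set) \<Rightarrow> (('c \<Rightarrow> 'v) \<times> 'c) set \<Rightarrow> 'c \<times> 'v) \<and>
     coprod_to_prod C (R_ob C) (R_mor C)
       (R_canonical C :: ('c \<Rightarrow> 'u set) \<Rightarrow> ('c \<Rightarrow> 'c \<times> 'u) \<Rightarrow> 'c \<Rightarrow> 'u) \<and>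
    \<comment> \<open>(3): the formulas characterise L and R; \<open>'v\<close> must not be a one-element type, as otherwise
        they do not determine the value on the empty contramodule\<close>
     ((\<exists>v w :: 'v. v \<noteq> w) \<longrightarrow>
      (\<forall>(Fo :: ('c, 'c \<Rightarrow> 'v) contramod \<Rightarrow> ('c, 'p) comod) Fm \<alpha>.
        contra_to_comod_functor C Fo Fm \<and> prod_to_coprod C Fo Fm \<alpha> \<longrightarrow>
        (\<exists>\<eta>. contra_to_comod_nat_iso C (product_contramodules C TYPE('v))
               Fo Fm (L_ob C) (L_mor C) \<eta>))) \<and>
     (\<forall>(Fo :: ('c, 'c \<times> 'u) comod \<Rightarrow> ('c, 'q) contramod) Fm \<alpha>.
        comod_to_contra_functor C Fo Fm \<and> coprod_to_prod C Fo Fm \<alpha> \<longrightarrow>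
        (\<exists>\<eta>. comod_to_contra_nat_iso C (coproduct_comodules C TYPE('u))
               Fo Fm (R_ob C) (R_mor C) \<eta>))"
proof (intro conjI L_functor R_functor L_prod_to_coprod R_coprod_to_prod allI impI)
  show "\<exists>U :: 'c \<Rightarrow> 'x set. comod_isomorphic C X (coprod_comod C U)"
    if "is_comodule C X" for X :: "('c, 'x) comod"
    using that by (rule comodule_isomorphic_coprod)
  show "\<exists>V :: 'c \<Rightarrow> 'y set. contra_isomorphic C Y (prod_contra C V)"
    if "is_contramodule C Y" for Y :: "('c, 'y) contramod"
    using that by (rule contramodule_isomorphic_prod)
next
  fix Fo :: "('c, 'c \<Rightarrow> 'v) contramod \<Rightarrow> ('c, 'p) comod" and Fm \<alpha>
  assume "\<exists>v w :: 'v. v \<noteq> w"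
    and "contra_to_comod_functor C Fo Fm \<and> prod_to_coprod C Fo Fm \<alpha>"
  then show "\<exists>\<eta>. contra_to_comod_nat_iso C (product_contramodules C TYPE('v))
      Fo Fm (L_ob C) (L_mor C) \<eta>"
    \<comment> \<open>\<open>L\<close> with its canonical maps is itself an instance of the formulas
      and serves as the second functor.\<close>
    using prod_to_coprod_unique[OF _ _ L_functor L_prod_to_coprod] by blast
next
  fix Fo :: "('c, 'c \<times> 'u) comod \<Rightarrow> ('c, 'q) contramod" and Fm \<alpha>
  assume "comod_to_contra_functor C Fo Fm \<and> coprod_to_prod C Fo Fm \<alpha>"
  then show "\<exists>\<eta>. comod_to_contra_nat_iso C (coproduct_comodules C TYPE('u))
      Fo Fm (R_ob C) (R_mor C) \<eta>"
    using coprod_to_prod_unique[OF _ _ R_functor R_coprod_to_prod] by blast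
qed

end
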